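(* Let $p=p(n)\in[0,1]$ and let $J_n$ be the average Jaccard index of the Erdős–Rényi random graph $G(n,p)$. If $np\to\infty$ and $n^2(1-p)\to\infty$ as $n\to\infty$, then $$\frac{n(2-p)^2}{\sqrt{8p(1-p)}}\Big(J_n-\frac{p}{2-p}\Big)\longrightarrow Z\quad\text{in distribution},$$ where $Z$ denotes a standard normal random variable.
   Context: $G(n,p)$ is the Erdős–Rényi random graph on the vertex set $[n]=\{1,\dots,n\}$, $n\ge 2$, in which each edge is present independently with probability $p=p(n)$, which may depend on $n$. For $i,j\in[n]$, $I_{ij}$ is the indicator that the edge between $i$ and $j$ is present; thus $I_{ii}=0$, $I_{ij}=I_{ji}$, and $\{I_{ij}:1\le i<j\le n\}$ are independent Bernoulli($p$) variables. With $a\vee b=\max(a,b)$, set for $i\ne j$ $$S_{ij}^{(n)}=\sum_{k\in[n],\,k\ne i,j}I_{ik}I_{jk},\qquad T_{ij}^{(n)}=\sum_{k\in[n],\,k\ne i,j}I_{ik}\vee I_{jk}.$$ The Jaccard index of distinct vertices $i,j$ is $J_{ij}^{(n)}=S_{ij}^{(n)}/T_{ij}^{(n)}$ if $T_{ij}^{(n)}>0$, and by convention $J_{ij}^{(n)}=p/(2-p)$ if $T_{ij}^{(n)}=0$. (So it is the number of common neighbours of $i$ and $j$ divided by the number of vertices other than $i,j$ adjacent to at least one of them.) The average Jaccard index is $$J_n=\frac{2}{n(n-1)}\sum_{i=1}^{n-1}\sum_{j=i+1}^{n}J_{ij}^{(n)}.$$ *)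

theory Defs
  imports "HOL-Probability.Probability"
begin

definition vertex_pairs :: "nat \<Rightarrow> nat set set" where
  "vertex_pairs n = {e. e \<subseteq> {1..n} \<and> card e = 2}"

text \<open>A simple graph on \<open>{1..n}\<close> is represented by its set of edges, each edge being a two-element
  subset of \<open>{1..n}\<close>.\<close>

definition erdos_renyi :: "nat \<Rightarrow> real \<Rightarrow> nat set set pmf" where
  "erdos_renyi n p =
     map_pmf (\<lambda>f. {e \<in> vertex_pairs n. f e})
       (Pi_pmf (vertex_pairs n) False (\<lambda>_. bernoulli_pmf p))"

text \<open>For an edge set \<open>E\<close> as above, \<open>edge_ind E i i = 0\<close> because \<open>{i, i}\<close> is a singleton.\<close>

definition edge_ind :: "nat set set \<Rightarrow> nat \<Rightarrow> nat \<Rightarrow> real" where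
  "edge_ind E i j = of_bool ({i, j} \<in> E)"

definition common_nbrs :: "nat \<Rightarrow> nat set set \<Rightarrow> nat \<Rightarrow> nat \<Rightarrow> real" where
  "common_nbrs n E i j = (\<Sum>k\<in>{1..n} - {i, j}. edge_ind E i k * edge_ind E j k)"

definition union_nbrs :: "nat \<Rightarrow> nat set set \<Rightarrow> nat \<Rightarrow> nat \<Rightarrow> real" where
  "union_nbrs n E i j = (\<Sum>k\<in>{1..n} - {i, j}. max (edge_ind E i k) (edge_ind E j k))"

text \<open>The parameter \<open>p\<close> enters only through the conventional value in the degenerate case.\<close>

definition jaccard :: "nat \<Rightarrow> real \<Rightarrow> nat set set \<Rightarrow> nat \<Rightarrow> nat \<Rightarrow> real" where
  "jaccard n p E i j =
     (if union_nbrs n E i j > 0 then common_nbrs n E i j / union_nbrs n E i j else p / (2 - p))"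

definition avg_jaccard :: "nat \<Rightarrow> real \<Rightarrow> nat set set \<Rightarrow> real" where
  "avg_jaccard n p E =
     2 / (real n * (real n - 1)) * (\<Sum>i=1..n-1. \<Sum>j=i+1..n. jaccard n p E i j)"

end

theory Submission
  imports Defs
begin

text \<open>Write \<open>q = 1 - p\<close> and \<open>N = n (n - 1) / 2\<close>. Flipping a single edge changes the expectation of \<open>J\<^sub>n\<close>
  by the same explicit amount \<open>d\<close> for every edge, because the convention \<open>J\<^sub>i\<^sub>j = p / (2 - p)\<close> for
  \<open>T\<^sub>i\<^sub>j = 0\<close> makes all expectations involved exactly computable; in particular \<open>J\<^sub>n\<close> has mean
  \<open>p / (2 - p)\<close>. A Poincare inequality for product Bernoulli measures, applied twice, bounds the
  second moment of \<open>J\<^sub>n - p / (2 - p) - d (\<Sum>\<^sub>e I\<^sub>e - p)\<close> by \<open>(p q)\<^sup>2\<close> times the sum over pairs of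
  distinct edges of the second moments of the mixed second differences of \<open>J\<^sub>n\<close>. Such a difference
  involves only four of the \<open>J\<^sub>i\<^sub>j\<close> if the two edges are disjoint and about \<open>n\<close> of them if they
  share a vertex, and each term is small by inverse moment bounds for binomial distributions. After
  normalisation the total error is \<open>O (1 / (n p))\<close>. The linear part is a
  centred binomial variable whose variance \<open>N p q\<close> tends to infinity, so its characteristic function
  converges to that of the normal law.\<close>

subsection \<open>Functions of a random subset\<close>

text \<open>Put x = n p, which may grow arbitrarily slowly. Small denominators are then too likely
  for a uniform expansion of the ratios, and only inverse moments are available. After
  normalisation, the mixed differences (multiplied by N) need second moments o(1/x) for adjacent
  edges and o(1/(n x)) for disjoint ones. For disjoint edges the bound is p / x^4 = 1/(n x^3), and
  its factor p is essential. It is there because a mixed difference is large only if a further edge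
  or a common neighbour is present, or through the default value, which is at most p. For adjacent
  edges, squaring termwise over about n indices would give n^2 p / x^4 = n / x^3, which is too much.
  The sum over the indices is therefore bounded pathwise, over a common denominator: the degree of
  the shared vertex. This gives 1/x^2. Expectations are finite weighted sums in an arbitrary real
  vector space, so real moments and complex characteristic functions share one operator; the product
  \<open>pmf\<close> is translated into it only at the end.\<close>

definition subset_exp :: "real \<Rightarrow> 'a set \<Rightarrow> ('a set \<Rightarrow> 'b::real_vector) \<Rightarrow> 'b" where
  "subset_exp p A F = (\<Sum>X\<in>Pow A. (p ^ card X * (1 - p) ^ card (A - X)) *\<^sub>R F X)"

lemma subset_exp_empty [simp]: "subset_exp p {} F = F {}"
  by (simp add: subset_exp_def)

lemma subset_exp_insert:
  assumes "finite A" "x \<notin> A"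
  shows "subset_exp p (insert x A) F =
    p *\<^sub>R subset_exp p A (\<lambda>X. F (insert x X)) + (1 - p) *\<^sub>R subset_exp p A F"
proof -
  let ?w = "\<lambda>B X. (p ^ card X * (1 - p) ^ card (B - X))"
  have disj: "Pow A \<inter> insert x ` Pow A = {}" using assms by auto
  have inj: "inj_on (insert x) (Pow A)" using assms by (auto simp: inj_on_def)
  have w0: "?w (insert x A) X = (1 - p) * ?w A X" if "X \<in> Pow A" for X
  proof -
    have "insert x A - X = insert x (A - X)" using that assms by auto
    then show ?thesis using assms by simp
  qed
  have w1: "?w (insert x A) (insert x X) = p * ?w A X" if "X \<in> Pow A" for X
  proof -
    have "insert x A - insert x X = A - X" using that assms by auto
    moreover have "card (insert x X) = Suc (card X)"
      using that assms by (metis PowD card_insert_disjoint finite_subset subset_iff)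
    ultimately show ?thesis by simp
  qed
  have "subset_exp p (insert x A) F =
      (\<Sum>X\<in>Pow A. ?w (insert x A) X *\<^sub>R F X) + (\<Sum>X\<in>Pow A. ?w (insert x A) (insert x X) *\<^sub>R F (insert x X))"
    unfolding subset_exp_def Pow_insert
    by (subst sum.union_disjoint) (use assms disj in \<open>auto simp: sum.reindex[OF inj]\<close>)
  also have "\<dots> = (1 - p) *\<^sub>R subset_exp p A F + p *\<^sub>R subset_exp p A (\<lambda>X. F (insert x X))"
    unfolding subset_exp_def scaleR_sum_right
    by (intro arg_cong2[where f="(+)"] sum.cong) (simp_all only: w0 w1 scaleR_scaleR)
  finally show ?thesis by simp
qed

lemma subset_exp_cong:
  "(\<And>X. X \<subseteq> A \<Longrightarrow> F X = G X) \<Longrightarrow> subset_exp p A F = subset_exp p A G"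
  unfolding subset_exp_def by (intro sum.cong) auto

lemma subset_exp_add: "subset_exp p A (\<lambda>X. F X + G X) = subset_exp p A F + subset_exp p A G"
  by (simp add: subset_exp_def scaleR_add_right sum.distrib)

lemma subset_exp_diff: "subset_exp p A (\<lambda>X. F X - G X) = subset_exp p A F - subset_exp p A G"
  by (simp add: subset_exp_def scaleR_diff_right sum_subtractf)

lemma subset_exp_sum: "subset_exp p A (\<lambda>X. \<Sum>i\<in>I. F i X) = (\<Sum>i\<in>I. subset_exp p A (F i))"
  unfolding subset_exp_def scaleR_sum_right by (rule sum.swap)

lemma subset_exp_cmult:
  "subset_exp p A (\<lambda>X. c * F X) = c * subset_exp p A F" for F :: "'a set \<Rightarrow> 'b::real_algebra"
  by (simp add: subset_exp_def sum_distrib_left)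

lemma subset_exp_const [simp]: "finite A \<Longrightarrow> subset_exp p A (\<lambda>X. c) = c"
  by (induction A rule: finite_induct) (auto simp: subset_exp_insert algebra_simps)

lemma subset_exp_mono:
  fixes F G :: "'a set \<Rightarrow> real"
  assumes "0 \<le> p" "p \<le> 1" "\<And>X. X \<subseteq> A \<Longrightarrow> F X \<le> G X"
  shows "subset_exp p A F \<le> subset_exp p A G"
  unfolding subset_exp_def using assms by (auto intro!: sum_mono mult_left_mono)

lemma subset_exp_nonneg:
  fixes F :: "'a set \<Rightarrow> real"
  assumes "0 \<le> p" "p \<le> 1" "\<And>X. X \<subseteq> A \<Longrightarrow> 0 \<le> F X"
  shows "0 \<le> subset_exp p A F"
  unfolding subset_exp_def using assms by (auto intro!: sum_nonneg mult_nonneg_nonneg)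

lemma norm_subset_exp_le:
  fixes F :: "'a set \<Rightarrow> 'b::real_normed_vector"
  assumes "0 \<le> p" "p \<le> 1"
  shows "norm (subset_exp p A F) \<le> subset_exp p A (\<lambda>X. norm (F X))"
  unfolding subset_exp_def using assms by (auto intro!: sum_norm_le)

text \<open>Both branches overwrite the status of \<open>x\<close>, so the ground set remains
  \<open>A\<close>. Several edges can thus be conditioned on in turn inside the fixed set
  \<open>vertex_pairs n\<close>.\<close>

lemma subset_exp_condition:
  assumes "finite A" "x \<in> A"
  shows "subset_exp p A F = subset_exp p A (\<lambda>X. p *\<^sub>R F (insert x X) + (1 - p) *\<^sub>R F (X - {x}))"
proof -
  have A: "A = insert x (A - {x})" "x \<notin> A - {x}" "finite (A - {x})" using assms by auto
  let ?B = "A - {x}"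
  have e: "subset_exp p ?B (\<lambda>X. F (X - {x})) = subset_exp p ?B F"
      "subset_exp p ?B (\<lambda>X. F (insert x X - {x})) = subset_exp p ?B F"
    by (intro subset_exp_cong arg_cong[where f = F]; auto)+
  have s: "subset_exp p ?B (\<lambda>X. c *\<^sub>R G X) = c *\<^sub>R subset_exp p ?B G" for c and G :: "'a set \<Rightarrow> 'b"
    by (simp add: subset_exp_def scaleR_sum_right mult.commute)
  have "subset_exp p (insert x ?B) F =
    subset_exp p (insert x ?B) (\<lambda>X. p *\<^sub>R F (insert x X) + (1 - p) *\<^sub>R F (X - {x}))"
    unfolding subset_exp_insert[OF A(3,2)] by (simp add: subset_exp_add s e flip: scaleR_add_left scaleR_add_right)
  then show ?thesis by (simp only: A(1)[symmetric])
qed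

lemma subset_exp_condition_real:
  fixes F :: "'a set \<Rightarrow> real"
  assumes "finite A" "x \<in> A"
  shows "subset_exp p A F = p * subset_exp p A (\<lambda>X. F (insert x X)) + (1 - p) * subset_exp p A (\<lambda>X. F (X - {x}))"
  by (subst subset_exp_condition[OF assms]) (simp add: subset_exp_add subset_exp_cmult)

lemma subset_exp_square:
  fixes F :: "'a set \<Rightarrow> real"
  assumes "0 \<le> p" "p \<le> 1" "finite A"
  shows "(subset_exp p A F)\<^sup>2 \<le> subset_exp p A (\<lambda>X. (F X)\<^sup>2)"
proof -
  define m where "m = subset_exp p A F"
  have "0 \<le> subset_exp p A (\<lambda>X. (F X - m)\<^sup>2)"
    by (intro subset_exp_nonneg assms) simp
  also have "(\<lambda>X. (F X - m)\<^sup>2) = (\<lambda>X. (F X)\<^sup>2 + m\<^sup>2 - 2 * m * F X)"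
    by (simp add: power2_diff algebra_simps)
  also have "subset_exp p A \<dots> = subset_exp p A (\<lambda>X. (F X)\<^sup>2) + m\<^sup>2 - 2 * m * m"
    using assms by (simp only: subset_exp_add subset_exp_diff subset_exp_cmult subset_exp_const m_def)
  finally show ?thesis by (simp add: m_def power2_eq_square)
qed

text \<open>Both arguments overwrite \<open>x\<close>, so this discrete derivative depends on the
  other elements only and a repetition in the same direction gives 0.\<close>

definition flip_diff :: "'a \<Rightarrow> ('a set \<Rightarrow> real) \<Rightarrow> 'a set \<Rightarrow> real" where
  "flip_diff x F X = F (insert x X) - F (X - {x})"

lemma flip_diff_self [simp]: "flip_diff x (flip_diff x F) X = 0"
  by (simp add: flip_diff_def)

text \<open>Efron-Stein inequality for independent indicators, adding one element at a time: the
  conditional variances are covered by the induction hypothesis, the variance of the conditional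
  mean by the derivative in the new direction.\<close>

lemma subset_exp_poincare:
  fixes F :: "'a set \<Rightarrow> real"
  assumes p: "0 \<le> p" "p \<le> 1" and fin: "finite A"
  shows "subset_exp p A (\<lambda>X. (F X)\<^sup>2) - (subset_exp p A F)\<^sup>2
    \<le> p * (1 - p) * (\<Sum>x\<in>A. subset_exp p A (\<lambda>X. (flip_diff x F X)\<^sup>2))"
  using fin
proof (induction A arbitrary: F rule: finite_induct)
  case empty
  then show ?case by simp
next
  case (insert x A)
  let ?E = "subset_exp p A"
  define F1 where "F1 = (\<lambda>X. F (insert x X))"
  define S where "S G = (\<Sum>y\<in>A. ?E (\<lambda>X. (flip_diff y G X)\<^sup>2))" for G
  have ins: "subset_exp p (insert x A) G = p * ?E (\<lambda>X. G (insert x X)) + (1 - p) * ?E G"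
    for G :: "'a set \<Rightarrow> real"
    using insert by (simp add: subset_exp_insert)
  have x: "subset_exp p (insert x A) (\<lambda>X. (flip_diff x F X)\<^sup>2) = ?E (\<lambda>X. (F1 X - F X)\<^sup>2)"
  proof -
    have "?E (\<lambda>X. (flip_diff x F X)\<^sup>2) = ?E (\<lambda>X. (F1 X - F X)\<^sup>2)"
      "?E (\<lambda>X. (flip_diff x F (insert x X))\<^sup>2) = ?E (\<lambda>X. (F1 X - F X)\<^sup>2)"
      using insert.hyps
      by (intro subset_exp_cong; auto simp: flip_diff_def F1_def insert_absorb Diff_insert_absorb
          intro!: arg_cong[where f = F] arg_cong2[where f="(-)"] arg_cong[where f = "\<lambda>x. x^2"])+
    then show ?thesis by (simp add: ins algebra_simps)
  qed
  have y: "subset_exp p (insert x A) (\<lambda>X. (flip_diff y F X)\<^sup>2) =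
     p * ?E (\<lambda>X. (flip_diff y F1 X)\<^sup>2) + (1 - p) * ?E (\<lambda>X. (flip_diff y F X)\<^sup>2)" if "y \<in> A" for y
  proof -
    have "y \<noteq> x" using that insert by auto
    then have "flip_diff y F (insert x X) = flip_diff y F1 X" for X
      by (simp add: flip_diff_def F1_def insert_commute insert_Diff_if)
    then show ?thesis by (simp add: ins)
  qed
  have sum: "(\<Sum>y\<in>insert x A. subset_exp p (insert x A) (\<lambda>X. (flip_diff y F X)\<^sup>2)) =
      ?E (\<lambda>X. (F1 X - F X)\<^sup>2) + (p * S F1 + (1 - p) * S F)"
    using insert.hyps by (simp add: x y S_def sum.distrib sum_distrib_left)
  define m1 m0 where "m1 = ?E F1" and "m0 = ?E F"
  have "(m1 - m0)\<^sup>2 \<le> ?E (\<lambda>X. (F1 X - F X)\<^sup>2)"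
    unfolding m1_def m0_def using subset_exp_square[OF p insert.hyps(1), of "\<lambda>X. F1 X - F X"]
    by (simp add: subset_exp_diff)
  then have 1: "p * (1 - p) * (m1 - m0)\<^sup>2 \<le> p * (1 - p) * ?E (\<lambda>X. (F1 X - F X)\<^sup>2)"
    using p by (intro mult_left_mono) auto
  have 2: "p * (?E (\<lambda>X. (F1 X)\<^sup>2) - m1\<^sup>2) \<le> p * (p * (1 - p) * S F1)"
    unfolding m1_def S_def using insert.IH[of F1] p by (intro mult_left_mono) auto
  have 3: "(1 - p) * (?E (\<lambda>X. (F X)\<^sup>2) - m0\<^sup>2) \<le> (1 - p) * (p * (1 - p) * S F)"
    unfolding m0_def S_def using insert.IH[of F] p by (intro mult_left_mono) auto
  \<comment> \<open>Law of total variance; the last term is the variance of the conditional mean, a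
    variable with the two values \<open>m1\<close> and \<open>m0\<close>.\<close>
  have "subset_exp p (insert x A) (\<lambda>X. (F X)\<^sup>2) - (subset_exp p (insert x A) F)\<^sup>2 =
     p * (?E (\<lambda>X. (F1 X)\<^sup>2) - m1\<^sup>2) + (1 - p) * (?E (\<lambda>X. (F X)\<^sup>2) - m0\<^sup>2) + p * (1 - p) * (m1 - m0)\<^sup>2"
    by (simp add: ins F1_def[symmetric] m1_def[symmetric] m0_def[symmetric])
       (simp add: F1_def power2_eq_square algebra_simps)
  also have "\<dots> \<le> p * (1 - p) * (?E (\<lambda>X. (F1 X - F X)\<^sup>2) + (p * S F1 + (1 - p) * S F))"
    using 1 2 3 by (simp add: algebra_simps)
  finally show ?case by (simp add: sum)
qed

definition centred_sum :: "real \<Rightarrow> 'a set \<Rightarrow> 'a set \<Rightarrow> real" where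
  "centred_sum p A X = (\<Sum>x\<in>A. of_bool (x \<in> X) - p)"

lemma subset_exp_ind:
  assumes "finite A" "x \<in> A" shows "subset_exp p A (\<lambda>X. of_bool (x \<in> X)) = p"
  using assms by (subst subset_exp_condition_real[OF assms]) simp

text \<open>Independence in algebraic form: the two invariance hypotheses say that \<open>G\<close>
  does not look at \<open>x\<close>.\<close>

lemma subset_exp_ind_mult:
  fixes G :: "'a set \<Rightarrow> real"
  assumes "finite A" "x \<in> A" "\<And>X. G (insert x X) = G X" "\<And>X. G (X - {x}) = G X"
  shows "subset_exp p A (\<lambda>X. of_bool (x \<in> X) * G X) = p * subset_exp p A G"
  using assms by (subst subset_exp_condition_real[OF assms(1,2)]) simp

lemma flip_diff_diff: "flip_diff x (\<lambda>X. F X - G X) X = flip_diff x F X - flip_diff x G X"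
  by (simp add: flip_diff_def)

lemma flip_diff_cmult: "flip_diff x (\<lambda>X. c * F X) X = c * flip_diff x F X"
  by (simp add: flip_diff_def algebra_simps)

lemma flip_diff_sum: "flip_diff x (\<lambda>X. \<Sum>i\<in>I. F i X) X = (\<Sum>i\<in>I. flip_diff x (F i) X)"
  by (simp add: flip_diff_def sum_subtractf)

lemma flip_diff_centred_sum:
  assumes "finite A" "x \<in> A" shows "flip_diff x (centred_sum p A) X = 1"
proof -
  have "flip_diff x (centred_sum p A) X = (\<Sum>y\<in>A. of_bool (x = y))"
    unfolding centred_sum_def flip_diff_sum by (intro sum.cong) (auto simp: flip_diff_def)
  also have "\<dots> = 1" using assms by simp
  finally show ?thesis .
qed

lemma subset_exp_centred_sum:
  "finite A \<Longrightarrow> subset_exp p A (centred_sum p A) = 0"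
  unfolding centred_sum_def subset_exp_sum by (simp add: subset_exp_diff subset_exp_ind)

text \<open>All derivatives equal 1, so the Poincare inequality yields the exact binomial variance
  as upper bound.\<close>

lemma subset_exp_centred_sum_square:
  assumes "0 \<le> p" "p \<le> 1" "finite A"
  shows "subset_exp p A (\<lambda>X. (centred_sum p A X)\<^sup>2) \<le> real (card A) * p * (1 - p)"
  using subset_exp_poincare[OF assms, of "centred_sum p A"] assms(3)
  by (simp add: subset_exp_centred_sum flip_diff_centred_sum mult_ac)

text \<open>Applying the Poincare inequality a second time, to the (centred) discrete derivatives of the
  remainder of the linear approximation, gives a bound in terms of mixed second differences only.\<close>

lemma subset_exp_second_order_poincare:
  fixes F :: "'a set \<Rightarrow> real"
  assumes p: "0 \<le> p" "p \<le> 1" and fin: "finite A"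
    and D: "\<And>x. x \<in> A \<Longrightarrow> subset_exp p A (flip_diff x F) = d"
  shows "subset_exp p A (\<lambda>X. (F X - subset_exp p A F - d * centred_sum p A X)\<^sup>2)
    \<le> (p * (1 - p))\<^sup>2 * (\<Sum>x\<in>A. \<Sum>y\<in>A - {x}. subset_exp p A (\<lambda>X. (flip_diff y (flip_diff x F) X)\<^sup>2))"
proof -
  let ?E = "subset_exp p A"
  define m where "m = ?E F"
  define G where "G = (\<lambda>X. F X - m - d * centred_sum p A X)"
  have EG: "?E G = 0"
    using fin by (simp add: G_def subset_exp_diff subset_exp_cmult subset_exp_centred_sum m_def)
  have DG: "flip_diff x G X = flip_diff x F X - d" if "x \<in> A" for x X
    using flip_diff_centred_sum[OF fin that, of p X] unfolding G_def flip_diff_diff flip_diff_cmult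
    by (simp add: flip_diff_def)
  have step: "?E (\<lambda>X. (flip_diff x G X)\<^sup>2) \<le> p * (1 - p) *
      (\<Sum>y\<in>A - {x}. ?E (\<lambda>X. (flip_diff y (flip_diff x F) X)\<^sup>2))" if x: "x \<in> A" for x
  proof -
    have D2: "flip_diff y (flip_diff x G) X = flip_diff y (flip_diff x F) X" for y X
      by (simp add: flip_diff_def[of y] DG[OF x])
    \<comment> \<open>Since \<open>d\<close> is the mean derivative, no squared mean is left over
      when the Poincare inequality is applied to \<open>flip_diff x G\<close>.\<close>
    have 0: "?E (flip_diff x G) = 0"
    proof -
      have "flip_diff x G = (\<lambda>X. flip_diff x F X - d)" using DG[OF x] by blast
      then show ?thesis using D[OF x] fin by (simp add: subset_exp_diff)
    qed
    have "?E (\<lambda>X. (flip_diff x G X)\<^sup>2) \<le> p * (1 - p) *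
      (\<Sum>y\<in>A. ?E (\<lambda>X. (flip_diff y (flip_diff x F) X)\<^sup>2))"
      using subset_exp_poincare[OF p fin, of "flip_diff x G"] by (simp add: 0 D2)
    also have "(\<Sum>y\<in>A. ?E (\<lambda>X. (flip_diff y (flip_diff x F) X)\<^sup>2)) =
        (\<Sum>y\<in>A - {x}. ?E (\<lambda>X. (flip_diff y (flip_diff x F) X)\<^sup>2))"
      using fin x by (subst sum.remove[of _ x]) auto
    finally show ?thesis .
  qed
  have "?E (\<lambda>X. (G X)\<^sup>2) \<le> p * (1 - p) * (\<Sum>x\<in>A. ?E (\<lambda>X. (flip_diff x G X)\<^sup>2))"
    using subset_exp_poincare[OF p fin, of G] EG by simp
  also have "\<dots> \<le> p * (1 - p) * (\<Sum>x\<in>A. p * (1 - p) *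
      (\<Sum>y\<in>A - {x}. ?E (\<lambda>X. (flip_diff y (flip_diff x F) X)\<^sup>2)))"
    using p by (intro mult_left_mono sum_mono step) auto
  finally show ?thesis
    by (simp add: G_def m_def power2_eq_square sum_distrib_left mult_ac)
qed

text \<open>The count over \<open>L\<close> is binomial and independent of \<open>G\<close>. With m
  = \<open>card L\<close> its second moment is (m p)^2 + m p (1 - p), and the factor 1 - p is
  dropped.\<close>

lemma subset_exp_sum_square_mult_le:
  fixes G :: "'a set \<Rightarrow> real"
  assumes p: "0 \<le> p" "p \<le> 1" and fin: "finite A" "L \<subseteq> A"
    and G0: "\<And>X. 0 \<le> G X"
    and G: "\<And>x X. x \<in> L \<Longrightarrow> G (insert x X) = G X" "\<And>x X. x \<in> L \<Longrightarrow> G (X - {x}) = G X"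
  shows "subset_exp p A (\<lambda>X. (\<Sum>x\<in>L. of_bool (x \<in> X))\<^sup>2 * G X)
    \<le> ((real (card L) * p)\<^sup>2 + real (card L) * p) * subset_exp p A G"
proof -
  let ?E = "subset_exp p A"
  have EG0: "0 \<le> ?E G" using p G0 by (intro subset_exp_nonneg)
  have finL: "finite L" using fin finite_subset by blast
  have one: "?E (\<lambda>X. of_bool (x \<in> X) * G X) = p * ?E G" if "x \<in> L" for x
    using that fin G by (intro subset_exp_ind_mult) auto
  have two: "?E (\<lambda>X. of_bool (x \<in> X) * (of_bool (y \<in> X) * G X)) \<le> (p\<^sup>2 + of_bool (x = y) * p) * ?E G"
    if xy: "x \<in> L" "y \<in> L" for x y
  proof (cases "x = y")
    case True
    then have "(\<lambda>X. of_bool (x \<in> X) * (of_bool (y \<in> X) * G X)) = (\<lambda>X. of_bool (x \<in> X) * G X)" by auto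
    then show ?thesis using one[OF xy(1)] True EG0 by (simp add: algebra_simps)
  next
    case False
    then have "?E (\<lambda>X. of_bool (x \<in> X) * (of_bool (y \<in> X) * G X)) = p * (p * ?E G)"
      using xy fin G by (subst subset_exp_ind_mult) (auto simp: one)
    then show ?thesis using False by (simp add: power2_eq_square)
  qed
  have "?E (\<lambda>X. (\<Sum>x\<in>L. of_bool (x \<in> X))\<^sup>2 * G X) =
      (\<Sum>x\<in>L. \<Sum>y\<in>L. ?E (\<lambda>X. of_bool (x \<in> X) * (of_bool (y \<in> X) * G X)))"
    unfolding subset_exp_sum[symmetric] power2_eq_square sum_product
    by (simp add: sum_distrib_right mult.assoc)
  also have "\<dots> \<le> (\<Sum>x\<in>L. \<Sum>y\<in>L. (p\<^sup>2 + of_bool (x = y) * p) * ?E G)"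
    by (intro sum_mono two)
  also have "\<dots> = ((real (card L) * p)\<^sup>2 + real (card L) * p) * ?E G"
    using finL by (simp add: sum.distrib flip: sum_distrib_right) (simp add: algebra_simps power2_eq_square)
  finally show ?thesis .
qed

section \<open>Binomial expectations and inverse moments\<close>

primrec binomial_exp :: "real \<Rightarrow> nat \<Rightarrow> (real \<Rightarrow> real) \<Rightarrow> real" where
  "binomial_exp p 0 f = f 0"
| "binomial_exp p (Suc M) f = p * binomial_exp p M (\<lambda>t. f (t + 1)) + (1 - p) * binomial_exp p M f"

text \<open>Arguments are real so that shifts by 1 need no casts, but the recursion evaluates
  \<open>f\<close> at natural numbers only; comparing there suffices and keeps denominators such as
  \<open>t + 1\<close> positive.\<close>

lemma binomial_exp_mono:
  assumes "0 \<le> p" "p \<le> 1" "\<And>k::nat. f (real k) \<le> g (real k)"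
  shows "binomial_exp p M f \<le> binomial_exp p M g"
  using assms(3)
proof (induction M arbitrary: f g)
  case 0
  from 0[of 0] show ?case by simp
next
  case (Suc M)
  have "binomial_exp p M (\<lambda>t. f (t + 1)) \<le> binomial_exp p M (\<lambda>t. g (t + 1))"
    by (rule Suc.IH) (metis Suc.prems of_nat_1 of_nat_add)
  then show ?case using Suc assms(1,2) by (auto intro!: add_mono mult_left_mono)
qed

lemma binomial_exp_cong:
  assumes "\<And>k::nat. f (real k) = g (real k)"
  shows "binomial_exp p M f = binomial_exp p M g"
  using assms
proof (induction M arbitrary: f g)
  case 0
  from 0[of 0] show ?case by simp
next
  case (Suc M)
  have 1: "binomial_exp p M (\<lambda>t. f (t + 1)) = binomial_exp p M (\<lambda>t. g (t + 1))"
    by (rule Suc.IH) (metis Suc.prems of_nat_1 of_nat_add)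
  have 2: "binomial_exp p M f = binomial_exp p M g"
    by (rule Suc.IH) (rule Suc.prems)
  show ?case by (simp only: binomial_exp.simps 1 2)
qed

lemma binomial_exp_const: "binomial_exp p M (\<lambda>t. c) = c"
  by (induction M) (auto simp: algebra_simps)

lemma binomial_exp_add:
  "binomial_exp p M (\<lambda>t. f t + g t) = binomial_exp p M f + binomial_exp p M g"
  by (induction M arbitrary: f g) (auto simp: algebra_simps)

lemma binomial_exp_cmult: "binomial_exp p M (\<lambda>t. c * f t) = c * binomial_exp p M f"
  by (induction M arbitrary: f) (auto simp: algebra_simps)

lemma binomial_exp_zero: "binomial_exp p M (\<lambda>t. of_bool (t = 0)) = (1 - p) ^ M"
proof (induction M)
  case (Suc M)
  have "binomial_exp p M (\<lambda>t. of_bool (t + 1 = 0)) = binomial_exp p M (\<lambda>t. 0)"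
    by (rule binomial_exp_cong) simp
  then show ?case using Suc by (simp add: binomial_exp_const)
qed simp

text \<open>Size biasing: weighting a binomial count of M + 1 trials by its own value produces one
  plus a binomial count of M trials. All inverse moments below come from this identity.\<close>

lemma binomial_exp_size_bias:
  "binomial_exp p (Suc M) (\<lambda>t. t * f t) = real (Suc M) * p * binomial_exp p M (\<lambda>t. f (t + 1))"
proof (induction M arbitrary: f)
  case (Suc M)
  define X where "X = binomial_exp p M (\<lambda>t. f (t + 1 + 1))"
  define Y where "Y = binomial_exp p (Suc M) (\<lambda>t. f (t + 1))"
  define Z where "Z = binomial_exp p M (\<lambda>t. f (t + 1))"
  have Y: "Y = p * X + (1 - p) * Z"
    unfolding X_def Y_def Z_def using binomial_exp.simps(2)[of p M "\<lambda>t. f (t + 1)"] .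
  have "binomial_exp p (Suc M) (\<lambda>t. (t + 1) * f (t + 1)) =
     binomial_exp p (Suc M) (\<lambda>t. t * f (t + 1)) + binomial_exp p (Suc M) (\<lambda>t. f (t + 1))"
    using binomial_exp_add[of p "Suc M" "\<lambda>t. t * f (t + 1)" "\<lambda>t. f (t + 1)"]
    by (simp only: distrib_right mult_1)
  also have "binomial_exp p (Suc M) (\<lambda>t. t * f (t + 1)) = real (Suc M) * p * X"
    unfolding X_def using Suc.IH[of "\<lambda>t. f (t + 1)"] .
  finally have 1: "binomial_exp p (Suc M) (\<lambda>t. (t + 1) * f (t + 1)) = real (Suc M) * p * X + Y"
    unfolding Y_def .
  have 2: "binomial_exp p (Suc M) (\<lambda>t. t * f t) = real (Suc M) * p * Z"
    unfolding Z_def using Suc.IH[of f] .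
  have "binomial_exp p (Suc (Suc M)) (\<lambda>t. t * f t) =
     p * binomial_exp p (Suc M) (\<lambda>t. (t + 1) * f (t + 1)) + (1 - p) * binomial_exp p (Suc M) (\<lambda>t. t * f t)"
    using binomial_exp.simps(2)[of p "Suc M" "\<lambda>t. t * f t"] .
  also have "\<dots> = real (Suc M) * p * (p * X + (1 - p) * Z) + p * Y"
    unfolding 1 2 by (simp add: algebra_simps)
  also have "\<dots> = real (Suc (Suc M)) * p * Y"
    unfolding Y[symmetric] by (simp add: algebra_simps)
  finally show ?case unfolding Y_def .
qed simp

lemma binomial_exp_inverse:
  assumes "0 < p"
  shows "binomial_exp p M (\<lambda>t. 1 / (t + 1)) = (1 - (1 - p) ^ Suc M) / (real (Suc M) * p)"
proof -
  \<comment> \<open>As 1 / 0 = 0, the function on the left is the indicator of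
    \<open>t \<noteq> 0\<close>.\<close>
  have "binomial_exp p (Suc M) (\<lambda>t. t * (1 / t)) = binomial_exp p (Suc M) (\<lambda>t. 1 + (-1) * of_bool (t = 0))"
    by (rule binomial_exp_cong) simp
  also have "\<dots> = 1 - (1 - p) ^ Suc M"
    by (simp only: binomial_exp_add binomial_exp_cmult binomial_exp_const binomial_exp_zero)
  finally have "real (Suc M) * p * binomial_exp p M (\<lambda>t. 1 / (t + 1)) = 1 - (1 - p) ^ Suc M"
    by (simp only: binomial_exp_size_bias)
  moreover have "real (Suc M) * p > 0" using assms by simp
  ultimately show ?thesis by (metis less_irrefl nonzero_mult_div_cancel_left)
qed

text \<open>Rising factorials are adapted to size biasing: multiplying \<open>g\<close> by
  \<open>t\<close> cancels its first factor, which lowers \<open>s\<close> by one. The price is one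
  more trial, and this only improves the bound.\<close>

lemma binomial_exp_inverse_rising:
  assumes p: "0 < p" "p \<le> 1"
  shows "binomial_exp p M (\<lambda>t. 1 / (\<Prod>i=1..s. t + real i)) \<le> 1 / (real (Suc M) * p) ^ s"
proof (induction s arbitrary: M)
  case 0
  then show ?case by (simp add: binomial_exp_const)
next
  case (Suc s)
  let ?c = "real (Suc M) * p"
  have c: "?c > 0" using p by simp
  define g where "g t = 1 / (\<Prod>i=0..s. t + real i)" for t
  have g1: "g (t + 1) = 1 / (\<Prod>i=1..Suc s. t + real i)" for t
  proof -
    have "(\<Prod>i=0..s. t + 1 + real i) = (\<Prod>i=Suc 0..Suc s. t + real i)"
      unfolding prod.shift_bounds_cl_Suc_ivl by (intro prod.cong) auto
    then show ?thesis by (simp add: g_def)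
  qed
  have "?c * binomial_exp p M (\<lambda>t. 1 / (\<Prod>i=1..Suc s. t + real i)) = binomial_exp p (Suc M) (\<lambda>t. t * g t)"
    unfolding binomial_exp_size_bias g1 ..
  also have "\<dots> \<le> binomial_exp p (Suc M) (\<lambda>t. 1 / (\<Prod>i=1..s. t + real i))"
  proof (rule binomial_exp_mono)
    fix k :: nat
    have "(\<Prod>i=0..s. real k + real i) = real k * (\<Prod>i=1..s. real k + real i)"
      by (simp add: prod.atLeast_Suc_atMost)
    \<comment> \<open>At k = 0 the left side is 0 because of the division by zero, so only an
      inequality holds.\<close>
    then show "real k * g (real k) \<le> 1 / (\<Prod>i=1..s. real k + real i)"
      unfolding g_def by (auto intro!: prod_nonneg)
  qed (use p in auto)
  also have "\<dots> \<le> 1 / (real (Suc (Suc M)) * p) ^ s" by (rule Suc.IH)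
  also have "\<dots> \<le> 1 / ?c ^ s"
    using p c by (intro divide_left_mono power_mono mult_right_mono) auto
  finally have "binomial_exp p M (\<lambda>t. 1 / (\<Prod>i=1..Suc s. t + real i)) \<le> 1 / ?c ^ s / ?c"
    by (subst pos_le_divide_eq[OF c]) (simp only: mult.commute)
  then show ?case by (simp only: divide_divide_eq_left power_Suc2)
qed

text \<open>For i >= 1 one has t + i <= i (t + 1), so the rising factorial is at most s! (t + 1)^s.
  This is the origin of the factors 24 and 2 in the later constants.\<close>

lemma binomial_exp_inverse_power:
  assumes p: "0 < p" "p \<le> 1"
  shows "binomial_exp p M (\<lambda>t. 1 / (t + 1) ^ s) \<le> fact s / (real (Suc M) * p) ^ s"
proof -
  have "binomial_exp p M (\<lambda>t. 1 / (t + 1) ^ s) \<le> binomial_exp p M (\<lambda>t. fact s * (1 / (\<Prod>i=1..s. t + real i)))"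
  proof (rule binomial_exp_mono)
    fix k :: nat
    have "(\<Prod>i=1..s. real k + real i) \<le> (\<Prod>i=1..s. real i * (real k + 1))"
    proof (intro prod_mono conjI)
      fix i assume "i \<in> {1..s}"
      then have "1 * real k \<le> real i * real k" by (intro mult_right_mono) auto
      then show "real k + real i \<le> real i * (real k + 1)" by (simp add: algebra_simps)
    qed simp
    also have "\<dots> = fact s * (real k + 1) ^ s"
      by (simp add: prod.distrib fact_prod)
    finally have "(\<Prod>i=1..s. real k + real i) \<le> fact s * (real k + 1) ^ s" .
    moreover have "0 < (\<Prod>i=1..s. real k + real i)" by (intro prod_pos) auto
    ultimately show "1 / (real k + 1) ^ s \<le> fact s * (1 / (\<Prod>i=1..s. real k + real i))"
      by (simp add: divide_simps)
  qed (use p in auto)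
  also have "\<dots> \<le> fact s * (1 / (real (Suc M) * p) ^ s)"
    unfolding binomial_exp_cmult by (intro mult_left_mono binomial_exp_inverse_rising p) auto
  finally show ?thesis by simp
qed

subsection \<open>Neighbourhood counts and Jaccard indices\<close>

text \<open>The default \<open>r\<close> stays free: the identities for edge flips hold for every
  \<open>r\<close>, and the value p / (2 - p) matters only for exact expectations and for
  \<open>r \<le> p\<close>.\<close>

definition jac :: "real \<Rightarrow> real \<Rightarrow> real \<Rightarrow> real" where
  "jac r s t = (if t > 0 then s / t else r)"

text \<open>A variable vertex set \<open>K\<close> allows single vertices to be split off, both in
  inductions on \<open>K\<close> and to isolate the ends of flipped edges.\<close>

definition common_on :: "nat set \<Rightarrow> nat \<Rightarrow> nat \<Rightarrow> nat set set \<Rightarrow> real" where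
  "common_on K i j X = (\<Sum>k\<in>K. edge_ind X i k * edge_ind X j k)"

definition union_on :: "nat set \<Rightarrow> nat \<Rightarrow> nat \<Rightarrow> nat set set \<Rightarrow> real" where
  "union_on K i j X = (\<Sum>k\<in>K. max (edge_ind X i k) (edge_ind X j k))"

definition degree_on :: "nat set \<Rightarrow> nat \<Rightarrow> nat set set \<Rightarrow> real" where
  "degree_on K i X = (\<Sum>k\<in>K. edge_ind X i k)"

definition jaccard_on :: "real \<Rightarrow> nat set \<Rightarrow> nat \<Rightarrow> nat \<Rightarrow> nat set set \<Rightarrow> real" where
  "jaccard_on r K i j X = jac r (common_on K i j X) (union_on K i j X)"

lemma jaccard_eq: "jaccard n p X i j = jaccard_on (p / (2 - p)) ({1..n} - {i, j}) i j X"
  by (simp add: jaccard_def jaccard_on_def jac_def common_on_def union_on_def common_nbrs_def union_nbrs_def)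

lemma edge_ind_01: "edge_ind X i j = 0 \<or> edge_ind X i j = 1"
  by (simp add: edge_ind_def)

lemma edge_ind_nonneg [simp]: "0 \<le> edge_ind X i j"
  by (simp add: edge_ind_def)

lemma edge_ind_le_1 [simp]: "edge_ind X i j \<le> 1"
  by (simp add: edge_ind_def)

lemma edge_ind_sym: "edge_ind X i j = edge_ind X j i"
  by (simp add: edge_ind_def insert_commute)

lemma edge_ind_insert:
  "edge_ind (insert {a, b} X) i k = (if a = i \<and> b = k \<or> a = k \<and> b = i then 1 else edge_ind X i k)"
proof -
  have "{i, k} = {a, b} \<longleftrightarrow> a = i \<and> b = k \<or> a = k \<and> b = i" by (auto simp: doubleton_eq_iff)
  moreover have "edge_ind (insert e X) i k = (if {i, k} = e then 1 else edge_ind X i k)" for e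
    by (simp add: edge_ind_def)
  ultimately show ?thesis by (simp only:)
qed

lemma edge_ind_delete:
  "edge_ind (X - {{a, b}}) i k = (if a = i \<and> b = k \<or> a = k \<and> b = i then 0 else edge_ind X i k)"
proof -
  have "{i, k} = {a, b} \<longleftrightarrow> a = i \<and> b = k \<or> a = k \<and> b = i" by (auto simp: doubleton_eq_iff)
  moreover have "edge_ind (X - {e}) i k = (if {i, k} = e then 0 else edge_ind X i k)" for e
    by (simp add: edge_ind_def)
  ultimately show ?thesis by (simp only:)
qed

lemma max_edge_ind [simp]:
  "max 1 (edge_ind X i j) = 1" "max (edge_ind X i j) 1 = 1"
  "max 0 (edge_ind X i j) = edge_ind X i j" "max (edge_ind X i j) 0 = edge_ind X i j"
  by (simp_all add: edge_ind_def)

lemma finite_vertex_pairs [simp]: "finite (vertex_pairs n)"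
  by (rule finite_subset[of _ "Pow {1..n}"]) (auto simp: vertex_pairs_def)

lemma doubleton_in_vertex_pairs:
  "{i, k} \<in> vertex_pairs n \<longleftrightarrow> i \<noteq> k \<and> i \<in> {1..n} \<and> k \<in> {1..n}"
  by (auto simp: vertex_pairs_def card_insert_if)

lemma vertex_pairsE:
  assumes "e \<in> vertex_pairs n"
  obtains a b where "e = {a, b}" "a \<noteq> b" "a \<in> {1..n}" "b \<in> {1..n}"
  using assms by (auto simp: vertex_pairs_def card_2_iff)

lemma card_vertex_pairs: "real (card (vertex_pairs n)) = real n * (real n - 1) / 2"
proof -
  have "card (vertex_pairs n) = n choose 2"
    using n_subsets[of "{1..n}" 2] by (simp add: vertex_pairs_def)
  then show ?thesis
    by (cases n) (auto simp: choose_two field_simps real_of_nat_div)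
qed

lemma common_on_flip [simp]:
  assumes "\<And>k. k \<in> K \<Longrightarrow> e \<noteq> {i, k}" "\<And>k. k \<in> K \<Longrightarrow> e \<noteq> {j, k}"
  shows "common_on K i j (insert e X) = common_on K i j X"
    and "common_on K i j (X - {e}) = common_on K i j X"
  unfolding common_on_def using assms by (auto intro!: sum.cong simp: edge_ind_def) metis+

lemma union_on_flip [simp]:
  assumes "\<And>k. k \<in> K \<Longrightarrow> e \<noteq> {i, k}" "\<And>k. k \<in> K \<Longrightarrow> e \<noteq> {j, k}"
  shows "union_on K i j (insert e X) = union_on K i j X"
    and "union_on K i j (X - {e}) = union_on K i j X"
  unfolding union_on_def using assms by (auto intro!: sum.cong simp: edge_ind_def) metis+

lemma degree_on_flip [simp]:
  assumes "\<And>k. k \<in> K \<Longrightarrow> e \<noteq> {i, k}"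
  shows "degree_on K i (insert e X) = degree_on K i X"
    and "degree_on K i (X - {e}) = degree_on K i X"
  unfolding degree_on_def using assms by (auto intro!: sum.cong simp: edge_ind_def) metis+

lemma common_on_insert [simp]:
  "finite K \<Longrightarrow> k \<notin> K \<Longrightarrow> common_on (insert k K) i j X = edge_ind X i k * edge_ind X j k + common_on K i j X"
  by (simp add: common_on_def)

lemma union_on_insert [simp]:
  "finite K \<Longrightarrow> k \<notin> K \<Longrightarrow> union_on (insert k K) i j X = max (edge_ind X i k) (edge_ind X j k) + union_on K i j X"
  by (simp add: union_on_def)

lemma degree_on_insert [simp]:
  "finite K \<Longrightarrow> k \<notin> K \<Longrightarrow> degree_on (insert k K) i X = edge_ind X i k + degree_on K i X"
  by (simp add: degree_on_def)

lemma common_on_nonneg: "0 \<le> common_on K i j X"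
  by (simp add: common_on_def sum_nonneg)

lemma degree_on_nonneg: "0 \<le> degree_on K i X"
  by (simp add: degree_on_def sum_nonneg)

lemma common_on_le_union_on: "common_on K i j X \<le> union_on K i j X"
  unfolding common_on_def union_on_def
  by (intro sum_mono) (auto simp: edge_ind_def)

lemma degree_on_le_union_on: "degree_on K i X \<le> union_on K i j X"
  unfolding degree_on_def union_on_def by (intro sum_mono) simp

lemma union_on_nonneg: "0 \<le> union_on K i j X"
  using common_on_nonneg common_on_le_union_on by (rule order_trans)

text \<open>Integrality provides the dichotomy between \<open>t = 0\<close> and
  \<open>t \<ge> 1\<close> in the bound on mixed differences.\<close>

lemma union_on_nat: obtains t :: nat where "union_on K i j X = real t"
proof -
  have "union_on K i j X = real (\<Sum>k\<in>K. if {i, k} \<in> X \<or> {j, k} \<in> X then 1 else 0)"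
    unfolding union_on_def of_nat_sum by (intro sum.cong) (auto simp: edge_ind_def)
  then show ?thesis using that by blast
qed

lemma jaccard_on_flip:
  assumes "\<And>k. k \<in> K \<Longrightarrow> e \<noteq> {i, k}" "\<And>k. k \<in> K \<Longrightarrow> e \<noteq> {j, k}"
  shows "flip_diff e (jaccard_on r K i j) X = 0"
  using assms by (simp add: flip_diff_def jaccard_on_def)

lemma jaccard_on_sym: "jaccard_on r K i j X = jaccard_on r K j i X"
  by (simp add: jaccard_on_def common_on_def union_on_def mult.commute max.commute)

lemma flip_diff_commute: "flip_diff x (flip_diff y F) X = flip_diff y (flip_diff x F) X"
proof (cases "x = y")
  case False
  then have "insert y (X - {x}) = insert y X - {x}" "insert x (X - {y}) = insert x X - {y}"
    "X - {x} - {y} = X - {y} - {x}" "insert x (insert y X) = insert y (insert x X)"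
    by auto
  then show ?thesis by (simp add: flip_diff_def)
qed simp

section \<open>Laws of the neighbourhood counts and exact expectations\<close>

lemma subset_exp_degree_on:
  assumes "finite K" "i \<in> {1..n}" "K \<subseteq> {1..n} - {i}"
  shows "subset_exp p (vertex_pairs n) (\<lambda>X. f (degree_on K i X)) = binomial_exp p (card K) f"
  using assms(1,3)
proof (induction K arbitrary: f rule: finite_induct)
  case empty
  then show ?case by (simp add: degree_on_def)
next
  case (insert k K)
  have e: "{i, k} \<in> vertex_pairs n" using insert assms by (auto simp: doubleton_in_vertex_pairs)
  have ne: "{i, k} \<noteq> {i, k'}" if "k' \<in> K" for k' using that insert by (auto simp: doubleton_eq_iff)
  show ?case
    by (subst subset_exp_condition_real[OF finite_vertex_pairs e])
       (use insert ne insert.IH[of f] insert.IH[of "\<lambda>t. f (t + 1)"] in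
         \<open>simp add: edge_ind_insert edge_ind_delete add.commute\<close>)
qed

text \<open>The vertex \<open>k\<close> is adjacent to both of \<open>i\<close>, \<open>j\<close>,
  to exactly one of them, or to neither. The middle case merges two configurations with the same
  effect on the counts, hence the factor 2.\<close>

lemma subset_exp_condition_pair:
  fixes G :: "nat set set \<Rightarrow> real"
  assumes "finite K" "k \<notin> K" "insert k K \<subseteq> {1..n} - {i, j}" "i \<in> {1..n}" "j \<in> {1..n}" "i \<noteq> j"
    and G: "\<And>X. G X = g (common_on (insert k K) i j X) (union_on (insert k K) i j X)"
  shows "subset_exp p (vertex_pairs n) G =
     p\<^sup>2 * subset_exp p (vertex_pairs n) (\<lambda>X. g (common_on K i j X + 1) (union_on K i j X + 1))
     + 2 * p * (1 - p) * subset_exp p (vertex_pairs n) (\<lambda>X. g (common_on K i j X) (union_on K i j X + 1))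
     + (1 - p)\<^sup>2 * subset_exp p (vertex_pairs n) (\<lambda>X. g (common_on K i j X) (union_on K i j X))"
proof -
  have e: "{i, k} \<in> vertex_pairs n" "{j, k} \<in> vertex_pairs n"
    using assms by (auto simp: doubleton_in_vertex_pairs)
  have ne: "{i, k} \<noteq> {i, k'}" "{i, k} \<noteq> {j, k'}" "{j, k} \<noteq> {i, k'}" "{j, k} \<noteq> {j, k'}" if "k' \<in> K" for k'
    using that assms by (auto simp: doubleton_eq_iff)
  have neq: "i \<noteq> k" "j \<noteq> k" "i \<noteq> j" "k \<noteq> i" "k \<noteq> j" "j \<noteq> i" using assms by auto
  have [simp]: "common_on K i j (insert {i, k} X) = common_on K i j X"
    "common_on K i j (insert {j, k} X) = common_on K i j X"
    "common_on K i j (X - {{i, k}}) = common_on K i j X"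
    "common_on K i j (X - {{j, k}}) = common_on K i j X"
    "union_on K i j (insert {i, k} X) = union_on K i j X"
    "union_on K i j (insert {j, k} X) = union_on K i j X"
    "union_on K i j (X - {{i, k}}) = union_on K i j X"
    "union_on K i j (X - {{j, k}}) = union_on K i j X" for X
    using ne by auto
  show ?thesis
    unfolding G
    by (subst subset_exp_condition_real[OF finite_vertex_pairs e(1)],
        subst (1 2) subset_exp_condition_real[OF finite_vertex_pairs e(2)])
       (use assms(1,2) neq in \<open>simp add: edge_ind_insert edge_ind_delete add.commute power2_eq_square algebra_simps\<close>)
qed

text \<open>Each vertex of \<open>K\<close> is hit independently with probability 1 - (1 - p)^2 = p
  (2 - p).\<close>

lemma subset_exp_union_on:
  assumes "finite K" "K \<subseteq> {1..n} - {i, j}" "i \<in> {1..n}" "j \<in> {1..n}" "i \<noteq> j"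
  shows "subset_exp p (vertex_pairs n) (\<lambda>X. f (union_on K i j X)) = binomial_exp (p * (2 - p)) (card K) f"
  using assms(1,2)
proof (induction K arbitrary: f rule: finite_induct)
  case empty
  then show ?case by (simp add: union_on_def)
next
  case (insert k K)
  have s: "K \<subseteq> {1..n} - {i, j}" using insert by auto
  let ?G = "\<lambda>X. f (union_on (insert k K) i j X)"
  have "subset_exp p (vertex_pairs n) ?G =
     p\<^sup>2 * subset_exp p (vertex_pairs n) (\<lambda>X. f (union_on K i j X + 1))
     + 2 * p * (1 - p) * subset_exp p (vertex_pairs n) (\<lambda>X. f (union_on K i j X + 1))
     + (1 - p)\<^sup>2 * subset_exp p (vertex_pairs n) (\<lambda>X. f (union_on K i j X))"
    by (rule subset_exp_condition_pair[OF insert.hyps insert.prems assms(3-5), where g = "\<lambda>s t. f t"]) simp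
  also have "\<dots> = p\<^sup>2 * binomial_exp (p * (2 - p)) (card K) (\<lambda>t. f (t + 1)) +
      2 * p * (1 - p) * binomial_exp (p * (2 - p)) (card K) (\<lambda>t. f (t + 1)) +
      (1 - p)\<^sup>2 * binomial_exp (p * (2 - p)) (card K) f"
    unfolding insert.IH[OF s, of f] insert.IH[OF s, of "\<lambda>t. f (t + 1)"] ..
  finally have "subset_exp p (vertex_pairs n) ?G = p * (2 - p) * binomial_exp (p * (2 - p)) (card K) (\<lambda>t. f (t + 1)) +
      (1 - p * (2 - p)) * binomial_exp (p * (2 - p)) (card K) f"
    by (simp add: power2_eq_square algebra_simps)
  then show ?case using insert.hyps by (simp del: union_on_insert)
qed

text \<open>Given which vertices are adjacent to \<open>i\<close> or \<open>j\<close>, each of them is a common neighbour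
  with probability \<open>p / (2 - p)\<close>.\<close>

lemma subset_exp_common_on:
  assumes "finite K" "K \<subseteq> {1..n} - {i, j}" "i \<in> {1..n}" "j \<in> {1..n}" "i \<noteq> j"
  shows "(2 - p) * subset_exp p (vertex_pairs n) (\<lambda>X. common_on K i j X * f (union_on K i j X)) =
    p * subset_exp p (vertex_pairs n) (\<lambda>X. union_on K i j X * f (union_on K i j X))"
  using assms(1,2)
proof (induction K arbitrary: f rule: finite_induct)
  case empty
  then show ?case by (simp add: union_on_def common_on_def)
next
  case (insert k K)
  let ?E = "subset_exp p (vertex_pairs n)"
  let ?C = "common_on K i j" and ?U = "union_on K i j"
  have s: "K \<subseteq> {1..n} - {i, j}" using insert by auto
  note IH = insert.IH[OF s]
  define A B A' B' F where "A = ?E (\<lambda>X. ?C X * f (?U X))" and "B = ?E (\<lambda>X. ?U X * f (?U X))"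
    and "A' = ?E (\<lambda>X. ?C X * f (?U X + 1))" and "B' = ?E (\<lambda>X. ?U X * f (?U X + 1))"
    and "F = ?E (\<lambda>X. f (?U X + 1))"
  have 1: "?E (\<lambda>X. common_on (insert k K) i j X * f (union_on (insert k K) i j X)) =
      p\<^sup>2 * (A' + F) + 2 * p * (1 - p) * A' + (1 - p)\<^sup>2 * A"
    using subset_exp_condition_pair[OF insert.hyps insert.prems assms(3-5) refl, of p "\<lambda>s t. s * f t"]
    by (simp only: A_def A'_def F_def distrib_right subset_exp_add mult_1)
  have 2: "?E (\<lambda>X. union_on (insert k K) i j X * f (union_on (insert k K) i j X)) =
      p\<^sup>2 * (B' + F) + 2 * p * (1 - p) * (B' + F) + (1 - p)\<^sup>2 * B"
    using subset_exp_condition_pair[OF insert.hyps insert.prems assms(3-5) refl, of p "\<lambda>s t. t * f t"]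
    by (simp only: B_def B'_def F_def distrib_right subset_exp_add mult_1)
  have 3: "(2 - p) * A = p * B" unfolding A_def B_def by (rule IH)
  have 4: "(2 - p) * A' = p * B'"
    unfolding A'_def B'_def using IH[of "\<lambda>t. f (t + 1)"] .
  have "(2 - p) * (p\<^sup>2 * (A' + F) + 2 * p * (1 - p) * A' + (1 - p)\<^sup>2 * A) =
     p\<^sup>2 * ((2 - p) * A') + (2 - p) * p\<^sup>2 * F + 2 * p * (1 - p) * ((2 - p) * A') + (1 - p)\<^sup>2 * ((2 - p) * A)"
    by (simp add: algebra_simps)
  also have "\<dots> = p * (p\<^sup>2 * (B' + F) + 2 * p * (1 - p) * (B' + F) + (1 - p)\<^sup>2 * B)"
    unfolding 3 4 by (simp add: algebra_simps power2_eq_square)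
  finally show ?case unfolding 1 2 .
qed

lemma subset_exp_common_on':
  assumes "finite K" "K \<subseteq> {1..n} - {i, j}" "i \<in> {1..n}" "j \<in> {1..n}" "i \<noteq> j" "p \<noteq> 2"
  shows "subset_exp p (vertex_pairs n) (\<lambda>X. common_on K i j X * f (union_on K i j X)) =
    p / (2 - p) * subset_exp p (vertex_pairs n) (\<lambda>X. union_on K i j X * f (union_on K i j X))"
proof -
  have "a = p / (2 - p) * b" if "(2 - p) * a = p * b" for a b
    using that assms(6) by (simp add: field_simps)
  then show ?thesis using subset_exp_common_on[OF assms(1-5)] .
qed

text \<open>With r = p / (2 - p), the ratio contributes r P(T > 0) and the convention contributes r
  P(T = 0), so the probability of the degenerate case cancels.\<close>

lemma subset_exp_jaccard_on:
  assumes "finite K" "K \<subseteq> {1..n} - {i, j}" "i \<in> {1..n}" "j \<in> {1..n}" "i \<noteq> j" "p \<le> 1"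
  shows "subset_exp p (vertex_pairs n) (jaccard_on (p / (2 - p)) K i j) = p / (2 - p)"
proof -
  let ?E = "subset_exp p (vertex_pairs n)"
  let ?C = "common_on K i j" and ?U = "union_on K i j"
  define r where "r = p / (2 - p)"
  have U: "?U X \<ge> 0" for X by (rule union_on_nonneg)
  have c: "?E (\<lambda>X. ?C X * (1 / ?U X)) = r * ?E (\<lambda>X. ?U X * (1 / ?U X))"
    unfolding r_def using assms(6) by (intro subset_exp_common_on'[OF assms(1-5)]) simp
  have "?E (jaccard_on r K i j) = ?E (\<lambda>X. ?C X * (1 / ?U X) + r * of_bool (?U X = 0))"
    using U by (intro subset_exp_cong) (auto simp: jaccard_on_def jac_def order_less_le)
  also have "\<dots> = r * ?E (\<lambda>X. ?U X * (1 / ?U X) + of_bool (?U X = 0))"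
    by (simp only: subset_exp_add subset_exp_cmult c distrib_left)
  also have "?E (\<lambda>X. ?U X * (1 / ?U X) + of_bool (?U X = 0)) = ?E (\<lambda>X. 1)"
    by (intro subset_exp_cong) auto
  finally show ?thesis by (simp add: r_def)
qed

text \<open>If {j,k} is present, flipping {i,k} changes the numerator only, by 1, over denominator U
  + 1. If it is absent, only the denominator changes; replacing the numerator by r U in expectation
  gives -r / (U + 1). Averaging the two cases leaves a multiple of the mean of 1 / (U + 1), which is
  explicit.\<close>

lemma subset_exp_flip_diff_jaccard_on:
  assumes "finite K" "K \<subseteq> {1..n} - {i, j, k}" "i \<in> {1..n}" "j \<in> {1..n}" "k \<in> {1..n}"
    "i \<noteq> j" "i \<noteq> k" "j \<noteq> k" "0 < p" "p \<le> 1"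
  shows "subset_exp p (vertex_pairs n) (flip_diff {i, k} (jaccard_on (p / (2 - p)) (insert k K) i j))
    = (1 - (1 - p) ^ (2 * Suc (card K))) / (real (Suc (card K)) * (2 - p)\<^sup>2)"
proof -
  let ?E = "subset_exp p (vertex_pairs n)"
  let ?C = "common_on K i j" and ?U = "union_on K i j"
  define r where "r = p / (2 - p)"
  define f where "f t = (if t = 0 then 0 else 1 / (t + 1) - 1 / t)" for t :: real
  define g where "g b s t = jac r (s + b) (t + 1) - jac r s (t + b)" for b s t
  have U: "?U X \<ge> 0" for X by (rule union_on_nonneg)
  have C0: "?C X = 0" if "?U X = 0" for X
    using common_on_nonneg[of K i j X] common_on_le_union_on[of K i j X] that by simp
  have s: "K \<subseteq> {1..n} - {i, j}" and k: "k \<notin> K" using assms by auto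
  have e: "{j, k} \<in> vertex_pairs n" using assms by (auto simp: doubleton_in_vertex_pairs)
  have ne: "{i, k} \<noteq> {i, k'}" "{i, k} \<noteq> {j, k'}" "{j, k} \<noteq> {i, k'}" "{j, k} \<noteq> {j, k'}" if "k' \<in> K" for k'
    using that assms by (auto simp: doubleton_eq_iff)
  have [simp]: "?C (insert {i, k} X) = ?C X" "?C (insert {j, k} X) = ?C X"
    "?C (X - {{i, k}}) = ?C X" "?C (X - {{j, k}}) = ?C X"
    "?U (insert {i, k} X) = ?U X" "?U (insert {j, k} X) = ?U X"
    "?U (X - {{i, k}}) = ?U X" "?U (X - {{j, k}}) = ?U X" for X
    using ne by auto
  have D: "flip_diff {i, k} (jaccard_on r (insert k K) i j) X = g (edge_ind X j k) (?C X) (?U X)" for X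
    using assms k
    by (simp add: flip_diff_def jaccard_on_def g_def edge_ind_insert edge_ind_delete add.commute)
  have "?E (flip_diff {i, k} (jaccard_on r (insert k K) i j)) =
      ?E (\<lambda>X. g (edge_ind X j k) (?C X) (?U X))" by (intro subset_exp_cong D)
  also have "\<dots> = p * ?E (\<lambda>X. g 1 (?C X) (?U X)) + (1 - p) * ?E (\<lambda>X. g 0 (?C X) (?U X))"
    by (subst subset_exp_condition_real[OF finite_vertex_pairs e])
       (use assms in \<open>simp add: edge_ind_insert edge_ind_delete\<close>)
  also have "?E (\<lambda>X. g 1 (?C X) (?U X)) = ?E (\<lambda>X. 1 / (?U X + 1))"
  proof (intro subset_exp_cong)
    fix X show "g 1 (?C X) (?U X) = 1 / (?U X + 1)"
      using U[of X] by (simp add: g_def jac_def flip: diff_divide_distrib)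
  qed
  also have "?E (\<lambda>X. g 0 (?C X) (?U X)) = ?E (\<lambda>X. ?C X * f (?U X) - r * of_bool (?U X = 0))"
  proof (intro subset_exp_cong)
    fix X show "g 0 (?C X) (?U X) = ?C X * f (?U X) - r * of_bool (?U X = 0)"
      using U[of X] C0[of X] by (auto simp: g_def jac_def f_def order_less_le right_diff_distrib)
  qed
  also have "\<dots> = r * ?E (\<lambda>X. ?U X * f (?U X)) - r * ?E (\<lambda>X. of_bool (?U X = 0))"
    unfolding subset_exp_diff subset_exp_cmult r_def
    using subset_exp_common_on'[OF assms(1) s assms(3,4,6), of p f] assms(10) by simp
  also have "\<dots> = r * ?E (\<lambda>X. ?U X * f (?U X) - of_bool (?U X = 0))"
    by (simp only: subset_exp_diff right_diff_distrib)
  \<comment> \<open>Both cases agree: for U > 0 by cancellation, and for U = 0 because the default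
    value contributes -1 = -1 / (0 + 1).\<close>
  also have "?E (\<lambda>X. ?U X * f (?U X) - of_bool (?U X = 0)) = ?E (\<lambda>X. (-1) * (1 / (?U X + 1)))"
  proof (intro subset_exp_cong)
    fix X show "?U X * f (?U X) - of_bool (?U X = 0) = (-1) * (1 / (?U X + 1))"
    proof (cases "?U X = 0")
      case False
      then have "?U X \<noteq> 0" "?U X + 1 \<noteq> 0" using U[of X] by simp_all
      then show ?thesis by (simp add: f_def right_diff_distrib divide_simps)
    qed simp
  qed
  also have "\<dots> = (-1) * ?E (\<lambda>X. 1 / (?U X + 1))" by (rule subset_exp_cmult)
  also have "p * ?E (\<lambda>X. 1 / (?U X + 1)) + (1 - p) * (r * ((-1) * ?E (\<lambda>X. 1 / (?U X + 1)))) =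
      (p - (1 - p) * r) * ?E (\<lambda>X. 1 / (?U X + 1))" by (simp add: algebra_simps)
  \<comment> \<open>This is the equation r (2 - p) = p.\<close>
  also have "p - (1 - p) * r = r" using assms by (simp add: r_def field_simps)
  also have "?E (\<lambda>X. 1 / (?U X + 1)) = binomial_exp (p * (2 - p)) (card K) (\<lambda>t. 1 / (t + 1))"
    by (rule subset_exp_union_on[OF assms(1) s assms(3,4,6)])
  also have "\<dots> = (1 - (1 - p * (2 - p)) ^ Suc (card K)) / (real (Suc (card K)) * (p * (2 - p)))"
    using assms by (intro binomial_exp_inverse) auto
  also have "1 - p * (2 - p) = (1 - p)\<^sup>2" by (simp add: power2_eq_square algebra_simps)
  also have "((1 - p)\<^sup>2) ^ Suc (card K) = (1 - p) ^ (2 * Suc (card K))" by (simp only: power_mult)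
  also have "r * ((1 - (1 - p) ^ (2 * Suc (card K))) / (real (Suc (card K)) * (p * (2 - p)))) =
      (1 - (1 - p) ^ (2 * Suc (card K))) / (real (Suc (card K)) * (2 - p)\<^sup>2)"
    using assms by (simp add: r_def power2_eq_square)
  finally show ?thesis by (simp add: r_def)
qed

text \<open>Mixed second difference of \<open>J\<^sub>i\<^sub>j\<close> in one edge at \<open>k\<close> and one edge at \<open>l\<close>: here \<open>b\<close> and \<open>c\<close>
  indicate the other edges joining \<open>k\<close> and \<open>l\<close> to \<open>{i, j}\<close>, and \<open>s\<close>, \<open>t\<close> are the counts over the
  remaining vertices.\<close>

definition mixed_diff :: "real \<Rightarrow> real \<Rightarrow> real \<Rightarrow> real \<Rightarrow> real \<Rightarrow> real" where
  "mixed_diff r b c s t = (jac r (s + b + c) (t + 2) - jac r (s + c) (t + b + 1))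
     - (jac r (s + b) (t + 1 + c) - jac r s (t + b + c))"

text \<open>For b = c = 1 all denominators coincide and the difference vanishes. If one of them is
  1, it is a first difference of 1 / t. If both are 0, it is s times a second difference of 1 / t.
  The summand \<open>p\<close> covers the default value when t = 0.\<close>

lemma abs_mixed_diff_le:
  assumes b: "b = 0 \<or> b = 1" and c: "c = 0 \<or> c = 1" and s: "0 \<le> s" "s \<le> t" and t: "t = real m"
    and r: "0 \<le> r" "r \<le> p"
  shows "\<bar>mixed_diff r b c s t\<bar> \<le> (b + c) / (t + 1)\<^sup>2 + (3 * s + p) / (t + 1) ^ 3"
proof -
  have t0: "t \<ge> 0" using s by simp
  have nn: "0 \<le> (3 * s + p) / (t + 1) ^ 3" using s r t0 by simp
  have one: "1 / (t + 1) - 1 / (t + 2) \<le> 1 / (t + 1)\<^sup>2"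
  proof -
    have "1 / (t + 1) - 1 / (t + 2) = 1 / ((t + 1) * (t + 2))" using t0 by (simp add: field_simps)
    also have "\<dots> \<le> 1 / (t + 1)\<^sup>2"
      unfolding power2_eq_square using t0 by (intro divide_left_mono mult_left_mono) auto
    finally show ?thesis .
  qed
  have one': "0 \<le> 1 / (t + 1) - 1 / (t + 2)" using t0 by (simp add: field_simps)
  consider "b = 1 \<and> c = 1" | "b + c = 1" "b = 1 \<and> c = 0 \<or> b = 0 \<and> c = 1" | "b = 0 \<and> c = 0" "t = 0" | "b = 0 \<and> c = 0" "t \<ge> 1"
    using b c t by (cases m) auto
  then show ?thesis
  proof cases
    case 1
    then have "mixed_diff r b c s t = 0"
      using t0 by (simp add: mixed_diff_def jac_def add.assoc flip: diff_divide_distrib)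
    then show ?thesis using 1 nn by simp
  next
    case 2
    have "mixed_diff r b c s t = 1 / (t + 2) - 1 / (t + 1)"
      using t0 2 by (auto simp: mixed_diff_def jac_def add_divide_distrib add.commute)
    then show ?thesis using one one' nn 2 by simp
  next
    case 3
    \<comment> \<open>Here s = t = 0 and the mixed difference is exactly \<open>r\<close>, which is
      at most \<open>p\<close>.\<close>
    then show ?thesis using s r by (simp add: mixed_diff_def jac_def)
  next
    case 4
    have eq: "mixed_diff r b c s t = s * (2 / (t * (t + 1) * (t + 2)))"
    proof -
      have "1 / (t + 2) - 1 / (t + 1) - (1 / (t + 1) - 1 / t) = 2 / (t * (t + 1) * (t + 2))"
      proof -
        have "t \<noteq> 0" "t + 1 \<noteq> 0" "t + 2 \<noteq> 0" using 4 by auto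
        then show ?thesis by (simp add: divide_simps)
      qed
      moreover have "mixed_diff r b c s t = s * (1 / (t + 2) - 1 / (t + 1) - (1 / (t + 1) - 1 / t))"
        using 4 by (simp add: mixed_diff_def jac_def algebra_simps)
      ultimately show ?thesis by simp
    qed
    \<comment> \<open>The constant 3 suffices from t = 1 on: 2 (t + 1)^2 <= 3 t (t + 2) amounts to
      t^2 + 2 t >= 2.\<close>
    have "(t + 1) ^ 3 * 2 \<le> 3 * (t * (t + 1) * (t + 2))"
    proof -
      have "2 * (t + 1)\<^sup>2 \<le> 3 * (t * (t + 2))"
        using mult_mono[of 1 t 1 t] 4 by (simp add: power2_eq_square algebra_simps)
      then have "2 * (t + 1)\<^sup>2 * (t + 1) \<le> 3 * (t * (t + 2)) * (t + 1)"
        using t0 by (intro mult_right_mono) auto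
      then show ?thesis by (simp add: power3_eq_cube power2_eq_square mult_ac)
    qed
    then have "2 / (t * (t + 1) * (t + 2)) \<le> 3 / (t + 1) ^ 3"
      using 4 by (simp add: frac_le_eq divide_simps mult_ac)
    then have "s * (2 / (t * (t + 1) * (t + 2))) \<le> s * (3 / (t + 1) ^ 3)"
      using s by (intro mult_left_mono) auto
    moreover have "0 \<le> s * (2 / (t * (t + 1) * (t + 2)))" using s 4 by simp
    moreover have "s * (3 / (t + 1) ^ 3) \<le> (3 * s + p) / (t + 1) ^ 3"
      using r t0 by (simp add: divide_right_mono)
    ultimately show ?thesis using 4 unfolding eq by simp
  qed
qed

text \<open>Both flipped edges end at the same candidate neighbour, so there is no gain over a first
  difference. That is affordable because a pair of adjacent edges affects only one index in this
  way.\<close>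

lemma abs_double_edge_diff_le:
  assumes "0 \<le> s" "s \<le> t" "0 \<le> r" "r \<le> 1"
  shows "\<bar>(jac r (s + 1) (t + 1) - jac r s (t + 1)) - (jac r s (t + 1) - jac r s t)\<bar> \<le> 2 / (t + 1)"
proof (cases "t = 0")
  case True
  then show ?thesis using assms by (simp add: jac_def)
next
  case False
  then have t: "t > 0" using assms by simp
  have "s / (t * (t + 1)) \<le> t / (t * (t + 1))" using assms t by (intro divide_right_mono) auto
  moreover have "(jac r (s + 1) (t + 1) - jac r s (t + 1)) - (jac r s (t + 1) - jac r s t) =
     1 / (t + 1) + s / (t * (t + 1))"
    using t by (simp add: jac_def field_simps)
  moreover have "0 \<le> s / (t * (t + 1))" "0 \<le> 1 / (t + 1)" using assms t by auto
  ultimately show ?thesis using t by simp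
qed

lemma flip_diff2_jaccard_on_disjoint:
  assumes "finite K" "i \<notin> K" "j \<notin> K" "k \<notin> K" "l \<notin> K" "distinct [i, j, k, l]"
  shows "flip_diff {j, l} (flip_diff {i, k} (jaccard_on r (insert k (insert l K)) i j)) X =
    mixed_diff r (edge_ind X j k) (edge_ind X i l) (common_on K i j X) (union_on K i j X)"
proof -
  have ne: "{x, y} \<noteq> {i, k'}" "{x, y} \<noteq> {j, k'}" if "k' \<in> K" "x = i \<or> x = j" "y = k \<or> y = l" for k' x y
    using that assms by (auto simp: doubleton_eq_iff)
  have [simp]: "common_on K i j (insert {x, y} X) = common_on K i j X"
      "common_on K i j (X - {{x, y}}) = common_on K i j X"
      "union_on K i j (insert {x, y} X) = union_on K i j X"
      "union_on K i j (X - {{x, y}}) = union_on K i j X" if "x = i \<or> x = j" "y = k \<or> y = l" for x y X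
    using ne that by auto
  show ?thesis using assms
    by (auto simp: flip_diff_def jaccard_on_def mixed_diff_def edge_ind_insert edge_ind_delete add_ac)
qed

text \<open>Both flipped edges leave \<open>i\<close>, so the remaining edges at \<open>k\<close>
  and \<open>l\<close> both go to \<open>j\<close>; for disjoint flips they go to different
  ends.\<close>

lemma flip_diff2_jaccard_on_adjacent:
  assumes "finite K" "i \<notin> K" "j \<notin> K" "k \<notin> K" "l \<notin> K" "distinct [i, j, k, l]"
  shows "flip_diff {i, l} (flip_diff {i, k} (jaccard_on r (insert k (insert l K)) i j)) X =
    mixed_diff r (edge_ind X j k) (edge_ind X j l) (common_on K i j X) (union_on K i j X)"
proof -
  have ne: "{x, y} \<noteq> {i, k'}" "{x, y} \<noteq> {j, k'}" if "k' \<in> K" "x = i \<or> x = j" "y = k \<or> y = l" for k' x y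
    using that assms by (auto simp: doubleton_eq_iff)
  have [simp]: "common_on K i j (insert {x, y} X) = common_on K i j X"
      "common_on K i j (X - {{x, y}}) = common_on K i j X"
      "union_on K i j (insert {x, y} X) = union_on K i j X"
      "union_on K i j (X - {{x, y}}) = union_on K i j X" if "x = i \<or> x = j" "y = k \<or> y = l" for x y X
    using ne that by auto
  show ?thesis using assms
    by (auto simp: flip_diff_def jaccard_on_def mixed_diff_def edge_ind_insert edge_ind_delete add_ac)
qed

lemma flip_diff2_jaccard_on_common:
  assumes "finite K" "i \<notin> K" "j \<notin> K" "k \<notin> K" "distinct [i, j, k]"
  shows "flip_diff {j, k} (flip_diff {i, k} (jaccard_on r (insert k K) i j)) X =
    (jac r (common_on K i j X + 1) (union_on K i j X + 1) - jac r (common_on K i j X) (union_on K i j X + 1))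
    - (jac r (common_on K i j X) (union_on K i j X + 1) - jac r (common_on K i j X) (union_on K i j X))"
proof -
  have ne: "{x, k} \<noteq> {i, k'}" "{x, k} \<noteq> {j, k'}" if "k' \<in> K" "x = i \<or> x = j" for k' x
    using that assms by (auto simp: doubleton_eq_iff)
  have [simp]: "common_on K i j (insert {x, k} X) = common_on K i j X"
      "common_on K i j (X - {{x, k}}) = common_on K i j X"
      "union_on K i j (insert {x, k} X) = union_on K i j X"
      "union_on K i j (X - {{x, k}}) = union_on K i j X" if "x = i \<or> x = j" for x X
    using ne that by auto
  show ?thesis using assms
    by (auto simp: flip_diff_def jaccard_on_def edge_ind_insert edge_ind_delete add_ac)
qed

subsection \<open>Discrete derivatives of the average Jaccard index\<close>

lemma subset_exp_degree_on_inverse_power: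
  assumes "W \<subseteq> {1..n} - {a}" "a \<in> {1..n}" "0 < p" "p \<le> 1"
  shows "subset_exp p (vertex_pairs n) (\<lambda>X. 1 / (degree_on W a X + 1) ^ s)
    \<le> fact s / (real (Suc (card W)) * p) ^ s"
proof -
  have "finite W" using assms(1) by (rule finite_subset) simp
  then show ?thesis
    using subset_exp_degree_on[of W a n p "\<lambda>t. 1 / (t + 1) ^ s"] assms
      binomial_exp_inverse_power[OF assms(3,4), of "card W" s] by simp
qed

lemma subset_exp_union_on_inverse_power:
  assumes "K \<subseteq> {1..n} - {i, j}" "i \<in> {1..n}" "j \<in> {1..n}" "i \<noteq> j" "0 < p" "p \<le> 1"
  shows "subset_exp p (vertex_pairs n) (\<lambda>X. 1 / (union_on K i j X + 1) ^ s)
    \<le> fact s / (real (Suc (card K)) * p) ^ s"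
proof -
  have "finite K" using assms(1) by (rule finite_subset) simp
  let ?c = "real (Suc (card K))"
  have "1 - p * (2 - p) = (1 - p)\<^sup>2" by (simp add: power2_eq_square algebra_simps)
  moreover have "0 \<le> (1 - p)\<^sup>2" by simp
  ultimately have "p * (2 - p) \<le> 1" by linarith
  moreover have "0 < p * (2 - p)" using assms by simp
  ultimately have q: "0 < p * (2 - p)" "p * (2 - p) \<le> 1" by auto
  have "subset_exp p (vertex_pairs n) (\<lambda>X. 1 / (union_on K i j X + 1) ^ s)
     \<le> fact s / (?c * (p * (2 - p))) ^ s"
    using subset_exp_union_on[OF \<open>finite K\<close> assms(1-4), of p "\<lambda>t. 1 / (t + 1) ^ s"]
      binomial_exp_inverse_power[OF q, of "card K" s] by simp
  \<comment> \<open>Since 2 - p >= 1, the success probability p (2 - p) may be lowered to p, which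
    gives the same form as the bound for degrees.\<close>
  also have "\<dots> \<le> fact s / (?c * p) ^ s"
  proof -
    have "?c * p \<le> ?c * (p * (2 - p))"
      using assms mult_left_mono[of 1 "2 - p" p] by (intro mult_left_mono) auto
    moreover have "0 < ?c * p" using assms by simp
    moreover from calculation have "0 < ?c * (p * (2 - p))" by linarith
    ultimately show ?thesis
      by (intro divide_left_mono power_mono mult_pos_pos zero_less_power) (use assms in \<open>auto simp: less_imp_le\<close>)
  qed
  finally show ?thesis .
qed

lemma three_squares_le: "(x + y + z)\<^sup>2 \<le> 3 * (x\<^sup>2 + y\<^sup>2 + z\<^sup>2)" for x y z :: real
  using sum_squares_bound[of x y] sum_squares_bound[of y z] sum_squares_bound[of x z]
  by (simp add: power2_eq_square algebra_simps)

lemma four_squares_le: "(x + y + z + w)\<^sup>2 \<le> 4 * (x\<^sup>2 + y\<^sup>2 + z\<^sup>2 + w\<^sup>2)" for x y z w :: real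
  using sum_squares_bound[of x y] sum_squares_bound[of y z] sum_squares_bound[of x z]
    sum_squares_bound[of x w] sum_squares_bound[of y w] sum_squares_bound[of z w]
  by (simp add: power2_eq_square algebra_simps)

lemma five_squares_le: "(x + y + z + w + v)\<^sup>2 \<le> 5 * (x\<^sup>2 + y\<^sup>2 + z\<^sup>2 + w\<^sup>2 + v\<^sup>2)" for x y z w v :: real
  using sum_squares_bound[of x y] sum_squares_bound[of y z] sum_squares_bound[of x z]
    sum_squares_bound[of x w] sum_squares_bound[of y w] sum_squares_bound[of z w]
    sum_squares_bound[of x v] sum_squares_bound[of y v] sum_squares_bound[of z v] sum_squares_bound[of w v]
  by (simp add: power2_eq_square algebra_simps)

section \<open>Edge flips of the average index\<close>

definition pair_jaccard :: "nat \<Rightarrow> real \<Rightarrow> nat \<Rightarrow> nat \<Rightarrow> nat set set \<Rightarrow> real" where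
  "pair_jaccard n p i j = jaccard_on (p / (2 - p)) ({1..n} - {i, j}) i j"

lemma pair_jaccard_sym: "pair_jaccard n p i j = pair_jaccard n p j i"
  by (auto simp: pair_jaccard_def jaccard_on_sym insert_commute)

text \<open>With ordered pairs an endpoint of the flipped edge can always be listed first, without
  regard to the order of the labels.\<close>

lemma sum_less_pairs:
  fixes h :: "nat \<Rightarrow> nat \<Rightarrow> real"
  assumes sym: "\<And>i j. h i j = h j i"
  shows "(\<Sum>i\<in>{1..n}. \<Sum>j\<in>{1..n} - {i}. h i j) = 2 * (\<Sum>i=1..n-1. \<Sum>j=i+1..n. h i j)"
proof -
  define L where "L = (\<Sum>i\<in>{1..n}. \<Sum>j\<in>{1..n}. if i < j then h i j else 0)"
  have "(\<Sum>i\<in>{1..n}. \<Sum>j\<in>{1..n} - {i}. h i j) =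
      (\<Sum>i\<in>{1..n}. \<Sum>j\<in>{1..n}. (if i < j then h i j else 0) + (if j < i then h j i else 0))"
  proof (rule sum.cong[OF refl])
    fix i assume i: "i \<in> {1..n}"
    have "(\<Sum>j\<in>{1..n}. (if i < j then h i j else 0) + (if j < i then h j i else 0)) =
       (\<Sum>j\<in>{1..n} - {i}. (if i < j then h i j else 0) + (if j < i then h j i else 0))"
      by (subst sum.remove[OF _ i]) auto
    also have "\<dots> = (\<Sum>j\<in>{1..n} - {i}. h i j)"
      using sym by (intro sum.cong) auto
    finally show "(\<Sum>j\<in>{1..n} - {i}. h i j) =
      (\<Sum>j\<in>{1..n}. (if i < j then h i j else 0) + (if j < i then h j i else 0))" ..
  qed
  also have "\<dots> = L + (\<Sum>i\<in>{1..n}. \<Sum>j\<in>{1..n}. if j < i then h j i else 0)"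
    by (simp add: L_def sum.distrib)
  also have "(\<Sum>i\<in>{1..n}. \<Sum>j\<in>{1..n}. if j < i then h j i else 0) = L"
    unfolding L_def by (rule sum.swap)
  also have "L = (\<Sum>i=1..n-1. \<Sum>j=i+1..n. h i j)"
  proof -
    have "L = (\<Sum>i\<in>{1..n}. \<Sum>j=i+1..n. h i j)"
      unfolding L_def
    proof (rule sum.cong[OF refl])
      fix i assume "i \<in> {1..n}"
      then have "{j \<in> {1..n}. i < j} = {i+1..n}" by auto
      then show "(\<Sum>j\<in>{1..n}. if i < j then h i j else 0) = (\<Sum>j=i+1..n. h i j)"
        by (simp add: sum.inter_filter[symmetric])
    qed
    also have "\<dots> = (\<Sum>i=1..n-1. \<Sum>j=i+1..n. h i j)"
      by (intro sum.mono_neutral_right) auto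
    finally show ?thesis .
  qed
  finally show ?thesis by simp
qed

lemma avg_jaccard_eq:
  "avg_jaccard n p X = 1 / (real n * (real n - 1)) * (\<Sum>i\<in>{1..n}. \<Sum>j\<in>{1..n} - {i}. pair_jaccard n p i j X)"
proof -
  have "pair_jaccard n p i j X = pair_jaccard n p j i X" for i j by (simp only: pair_jaccard_sym)
  from sum_less_pairs[of "\<lambda>i j. pair_jaccard n p i j X", OF this, where n = n] show ?thesis
    by (simp add: avg_jaccard_def jaccard_eq pair_jaccard_def)
qed

text \<open>Isolates the pairs with exactly one element in {a,b}; only their indices react to the
  edge {a,b}, and each occurs in both orders.\<close>

lemma sum_pairs_meeting:
  fixes h :: "'a \<Rightarrow> 'a \<Rightarrow> real"
  assumes fin: "finite V" and ab: "a \<in> V" "b \<in> V" "a \<noteq> b"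
    and sym: "\<And>i j. h i j = h j i"
    and 0: "\<And>i j. i \<notin> {a, b} \<Longrightarrow> j \<notin> {a, b} \<Longrightarrow> h i j = 0" "h a b = 0"
  shows "(\<Sum>i\<in>V. \<Sum>j\<in>V - {i}. h i j) = 2 * (\<Sum>j\<in>V - {a, b}. h a j + h b j)"
proof -
  let ?W = "V - {a, b}"
  have V: "V = insert a (insert b ?W)" using ab by auto
  have finW: "finite ?W" "a \<notin> ?W" "b \<notin> ?W" using fin by auto
  have a: "(\<Sum>j\<in>V - {a}. h a j) = (\<Sum>j\<in>?W. h a j)"
  proof -
    have *: "V - {a} = insert b ?W" using ab by auto
    show ?thesis unfolding * using sum.insert[OF finW(1,3), of "h a"] 0(2) by simp
  qed
  have b: "(\<Sum>j\<in>V - {b}. h b j) = (\<Sum>j\<in>?W. h b j)"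
  proof -
    have *: "V - {b} = insert a ?W" using ab by auto
    show ?thesis unfolding * using sum.insert[OF finW(1,2), of "h b"] 0(2) sym[of b a] by linarith
  qed
  have i: "(\<Sum>j\<in>V - {i}. h i j) = h a i + h b i" if "i \<in> ?W" for i
  proof -
    have *: "V - {i} = insert a (insert b (?W - {i}))" using ab that by auto
    have 1: "(\<Sum>j\<in>?W - {i}. h i j) = 0" using that by (intro sum.neutral) (auto intro: 0)
    have 2: "finite (?W - {i})" "b \<notin> ?W - {i}" "finite (insert b (?W - {i}))" "a \<notin> insert b (?W - {i})"
      using fin ab by auto
    show ?thesis
      unfolding * using sum.insert[OF 2(3,4), of "h i"] sum.insert[OF 2(1,2), of "h i"] 1 sym[of i a] sym[of i b]
      by linarith
  qed
  have 2: "finite (insert b ?W)" "a \<notin> insert b ?W" using finW ab by auto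
  have "(\<Sum>i\<in>V. \<Sum>j\<in>V - {i}. h i j) =
     (\<Sum>j\<in>V - {a}. h a j) + ((\<Sum>j\<in>V - {b}. h b j) + (\<Sum>i\<in>?W. \<Sum>j\<in>V - {i}. h i j))"
    using sum.insert[OF 2, of "\<lambda>i. \<Sum>j\<in>V - {i}. h i j"]
      sum.insert[OF finW(1,3), of "\<lambda>i. \<Sum>j\<in>V - {i}. h i j"] V by (simp only:)
  also have "\<dots> = 2 * (\<Sum>j\<in>?W. h a j + h b j)"
    unfolding a b by (simp add: i sum.distrib)
  finally show ?thesis .
qed

text \<open>The index of \<open>i\<close> and \<open>j\<close> reads only edges joining {i,j} to a
  third vertex.\<close>

lemma pair_jaccard_flip:
  assumes "e \<inter> {i, j} = {} \<or> e = {i, j}"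
  shows "flip_diff e (pair_jaccard n p i j) X = 0"
  unfolding pair_jaccard_def using assms
  by (intro jaccard_on_flip) (auto simp: doubleton_eq_iff)

lemma flip_diff_avg_jaccard:
  assumes "a \<in> {1..n}" "b \<in> {1..n}" "a \<noteq> b"
  shows "flip_diff {a, b} (avg_jaccard n p) X = 2 / (real n * (real n - 1)) *
    (\<Sum>j\<in>{1..n} - {a, b}. flip_diff {a, b} (pair_jaccard n p a j) X + flip_diff {a, b} (pair_jaccard n p b j) X)"
proof -
  let ?h = "\<lambda>i j. flip_diff {a, b} (pair_jaccard n p i j) X"
  have "flip_diff {a, b} (avg_jaccard n p) X =
     1 / (real n * (real n - 1)) * (\<Sum>i\<in>{1..n}. \<Sum>j\<in>{1..n} - {i}. ?h i j)"
    unfolding flip_diff_sum[symmetric] flip_diff_cmult[symmetric]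
    by (simp only: flip_diff_def avg_jaccard_eq)
  also have "(\<Sum>i\<in>{1..n}. \<Sum>j\<in>{1..n} - {i}. ?h i j) = 2 * (\<Sum>j\<in>{1..n} - {a, b}. ?h a j + ?h b j)"
  proof (rule sum_pairs_meeting)
    show "?h i j = ?h j i" for i j by (simp only: pair_jaccard_sym)
  qed (use assms in \<open>auto intro!: pair_jaccard_flip\<close>)
  finally show ?thesis by simp
qed

lemma flip_diff2_eq_0:
  assumes "\<And>X. flip_diff x F X = 0"
  shows "flip_diff y (flip_diff x F) X = 0" "flip_diff x (flip_diff y F) X = 0"
  using assms by (simp_all add: flip_diff_def[of y] flip_diff_commute[of x])

lemma flip_diff2_avg_jaccard:
  assumes "a \<in> {1..n}" "b \<in> {1..n}" "a \<noteq> b"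
  shows "flip_diff f (flip_diff {a, b} (avg_jaccard n p)) X = 2 / (real n * (real n - 1)) *
    (\<Sum>j\<in>{1..n} - {a, b}. flip_diff f (flip_diff {a, b} (pair_jaccard n p a j)) X
       + flip_diff f (flip_diff {a, b} (pair_jaccard n p b j)) X)"
proof -
  have "flip_diff {a, b} (avg_jaccard n p) = (\<lambda>X. 2 / (real n * (real n - 1)) *
    (\<Sum>j\<in>{1..n} - {a, b}. flip_diff {a, b} (pair_jaccard n p a j) X + flip_diff {a, b} (pair_jaccard n p b j) X))"
    using flip_diff_avg_jaccard[OF assms] by blast
  then show ?thesis
    by (simp only: flip_diff_cmult flip_diff_sum)
       (simp only: flip_diff_def[of f] add_diff_add)
qed

text \<open>An index reads both edges only if it has one endpoint in each of them, which leaves four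
  pairs.\<close>

lemma flip_diff2_avg_jaccard_disjoint:
  assumes "{a, b, c, d} \<subseteq> {1..n}" "distinct [a, b, c, d]"
  shows "flip_diff {c, d} (flip_diff {a, b} (avg_jaccard n p)) X = 2 / (real n * (real n - 1)) *
    (flip_diff {c, d} (flip_diff {a, b} (pair_jaccard n p a c)) X
     + flip_diff {c, d} (flip_diff {a, b} (pair_jaccard n p a d)) X
     + flip_diff {c, d} (flip_diff {a, b} (pair_jaccard n p b c)) X
     + flip_diff {c, d} (flip_diff {a, b} (pair_jaccard n p b d)) X)"
proof -
  let ?h = "\<lambda>j. flip_diff {c, d} (flip_diff {a, b} (pair_jaccard n p a j)) X
     + flip_diff {c, d} (flip_diff {a, b} (pair_jaccard n p b j)) X"
  have "?h j = 0" if "j \<in> {1..n} - {a, b} - {c, d}" for j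
    using that assms by (simp add: flip_diff2_eq_0 pair_jaccard_flip)
  then have "(\<Sum>j\<in>{1..n} - {a, b}. ?h j) = (\<Sum>j\<in>{c, d}. ?h j)"
    using assms by (intro sum.mono_neutral_right) auto
  then show ?thesis
    using assms by (subst flip_diff2_avg_jaccard) (auto simp: algebra_simps)
qed

text \<open>A pair must meet each of the two edges in exactly one vertex: it is either {a,j} with
  \<open>j\<close> outside, or {b,c}. The pairs {a,b} and {a,c} drop out because each of them is
  itself one of the flipped edges.\<close>

lemma flip_diff2_avg_jaccard_adjacent:
  assumes "{a, b, c} \<subseteq> {1..n}" "distinct [a, b, c]"
  shows "flip_diff {a, c} (flip_diff {a, b} (avg_jaccard n p)) X = 2 / (real n * (real n - 1)) *
    ((\<Sum>j\<in>{1..n} - {a, b, c}. flip_diff {a, c} (flip_diff {a, b} (pair_jaccard n p a j)) X)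
     + flip_diff {a, c} (flip_diff {a, b} (pair_jaccard n p b c)) X)"
proof -
  let ?W = "{1..n} - {a, b, c}"
  have W: "{1..n} - {a, b} = insert c ?W" using assms by auto
  have 1: "flip_diff {a, c} (flip_diff {a, b} (pair_jaccard n p a c)) X = 0"
    by (intro flip_diff2_eq_0 pair_jaccard_flip) auto
  have 2: "flip_diff {a, c} (flip_diff {a, b} (pair_jaccard n p b j)) X = 0" if "j \<in> ?W" for j
    using that assms by (intro flip_diff2_eq_0 pair_jaccard_flip) auto
  define h where "h x j = flip_diff {a, c} (flip_diff {a, b} (pair_jaccard n p x j)) X" for x j
  have "(\<Sum>j\<in>{1..n} - {a, b}. h a j + h b j) = h a c + h b c + (\<Sum>j\<in>?W. h a j + h b j)"
    unfolding W by (rule sum.insert) auto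
  also have "(\<Sum>j\<in>?W. h a j + h b j) = (\<Sum>j\<in>?W. h a j)"
    by (rule sum.cong) (auto simp: h_def 2)
  also have "h a c = 0" unfolding h_def by (rule 1)
  finally show ?thesis
    using assms flip_diff2_avg_jaccard[of a n b "{a, c}" p X] unfolding h_def by simp
qed

section \<open>Second moments of mixed differences\<close>

lemma subset_exp_flip_diff2_pair_jaccard_le:
  assumes V: "{i, j, k, l} \<subseteq> {1..n}" and d: "distinct [i, j, k, l]" and p: "0 < p" "p \<le> 1"
  shows "subset_exp p (vertex_pairs n) (\<lambda>X. (flip_diff {j, l} (flip_diff {i, k} (pair_jaccard n p i j)) X)\<^sup>2)
    \<le> 1008 * p / (real (n - 3) * p) ^ 4"
proof -
  let ?E = "subset_exp p (vertex_pairs n)"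
  define K where "K = {1..n} - {i, j, k, l}"
  have K: "finite K" "i \<notin> K" "j \<notin> K" "k \<notin> K" "l \<notin> K" "K \<subseteq> {1..n} - {i, j}" by (auto simp: K_def)
  have W: "{1..n} - {i, j} = insert k (insert l K)" using V d by (auto simp: K_def)
  have card: "Suc (card K) = n - 3"
  proof -
    have "card {i, j, k, l} = 4" using d by simp
    moreover have "card {i, j, k, l} \<le> card {1..n}" using V by (intro card_mono) auto
    moreover have "card K = card {1..n} - card {i, j, k, l}"
      unfolding K_def using V by (intro card_Diff_subset) auto
    ultimately show ?thesis by simp
  qed
  have ij: "i \<in> {1..n}" "j \<in> {1..n}" "i \<noteq> j" using V d by auto
  define r where "r = p / (2 - p)"
  have r: "0 \<le> r" "r \<le> p" using p mult_left_mono[of 1 "2 - p" p] by (auto simp: r_def field_simps)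
  let ?C = "common_on K i j" and ?U = "union_on K i j"
  define E4 where "E4 = ?E (\<lambda>X. 1 / (?U X + 1) ^ 4)"
  have E4: "E4 \<le> 24 / (real (n - 3) * p) ^ 4"
    using subset_exp_union_on_inverse_power[OF K(6) ij p, of 4] unfolding card E4_def
    by (simp add: fact_numeral)
  have E40: "0 \<le> E4" unfolding E4_def using p union_on_nonneg[of K i j] by (intro subset_exp_nonneg) auto
  \<comment> \<open>Every term on the right contains an edge indicator, a common neighbour count or
    an explicit p, so each will contribute the required factor p in expectation.\<close>
  have pw: "(flip_diff {j, l} (flip_diff {i, k} (pair_jaccard n p i j)) X)\<^sup>2 \<le>
     3 * (edge_ind X j k * (1 / (?U X + 1) ^ 4)) + 3 * (edge_ind X i l * (1 / (?U X + 1) ^ 4))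
     + (27 * (?C X * (1 / (?U X + 1) ^ 5)) + 9 * p * (1 / (?U X + 1) ^ 5))" for X
  proof -
    define b c s t where "b = edge_ind X j k" and "c = edge_ind X i l" and "s = ?C X" and "t = ?U X"
    obtain m where m: "t = real m" using union_on_nat[of K i j X] t_def by blast
    have s: "0 \<le> s" "s \<le> t" unfolding s_def t_def by (rule common_on_nonneg common_on_le_union_on)+
    have b: "b = 0 \<or> b = 1" "b\<^sup>2 = b" and c: "c = 0 \<or> c = 1" "c\<^sup>2 = c"
      using edge_ind_01[of X] unfolding b_def c_def by (auto simp: edge_ind_def)
    have t1: "0 < t + 1" using s by simp
    define x y z where "x = b / (t + 1)\<^sup>2" and "y = c / (t + 1)\<^sup>2" and "z = (3 * s + p) / (t + 1) ^ 3"
    have "\<bar>flip_diff {j, l} (flip_diff {i, k} (pair_jaccard n p i j)) X\<bar> = \<bar>mixed_diff r b c s t\<bar>"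
      unfolding pair_jaccard_def W b_def c_def s_def t_def r_def
      using K d by (subst flip_diff2_jaccard_on_disjoint) auto
    also have "\<dots> \<le> x + y + z"
      using abs_mixed_diff_le[OF b(1) c(1) s m r] unfolding x_def y_def z_def by (simp add: add_divide_distrib)
    finally have "(flip_diff {j, l} (flip_diff {i, k} (pair_jaccard n p i j)) X)\<^sup>2 \<le> (x + y + z)\<^sup>2"
      by (rule abs_le_square_iff[THEN iffD1, OF order_trans[OF _ abs_ge_self]])
    also have "\<dots> \<le> 3 * (x\<^sup>2 + y\<^sup>2 + z\<^sup>2)" by (rule three_squares_le)
    also have "x\<^sup>2 = b * (1 / (t + 1) ^ 4)" unfolding x_def power_divide b(2) by (simp flip: power_mult)
    also have "y\<^sup>2 = c * (1 / (t + 1) ^ 4)" unfolding y_def power_divide c(2) by (simp flip: power_mult)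
    \<comment> \<open>Only one factor 3 s + p is bounded, by 3 (t + 1); the other one stays linear
      in s so that its expectation can be computed.\<close>
    also have "z\<^sup>2 \<le> 3 * ((3 * s + p) * (1 / (t + 1) ^ 5))"
    proof -
      have "(3 * s + p)\<^sup>2 \<le> (3 * s + p) * (3 * (t + 1))"
        unfolding power2_eq_square using s p by (intro mult_left_mono) auto
      then have "(3 * s + p)\<^sup>2 / (t + 1) ^ 6 \<le> (3 * s + p) * (3 * (t + 1)) / (t + 1) ^ 6"
        using t1 by (intro divide_right_mono) auto
      also have "(t + 1) ^ 6 = (t + 1) * (t + 1) ^ 5" by (simp add: eval_nat_numeral)
      also have "(3 * s + p) * (3 * (t + 1)) / ((t + 1) * (t + 1) ^ 5) = 3 * ((3 * s + p) * (1 / (t + 1) ^ 5))"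
        using t1 by (simp add: divide_simps) (simp add: algebra_simps)
      finally show ?thesis unfolding z_def power_divide using t1 by (simp add: eval_nat_numeral mult.assoc)
    qed
    finally show ?thesis unfolding b_def c_def s_def t_def by (simp add: algebra_simps add_divide_distrib)
  qed
  have Uflip: "?U (insert {x, y} X) = ?U X" "?U (X - {{x, y}}) = ?U X"
    if "x = i \<or> x = j" "y = k \<or> y = l" for x y X
  proof -
    have "{x, y} \<noteq> {i, k'}" "{x, y} \<noteq> {j, k'}" if "k' \<in> K" for k'
      using that \<open>x = i \<or> x = j\<close> \<open>y = k \<or> y = l\<close> K d by (auto simp: doubleton_eq_iff)
    then show "?U (insert {x, y} X) = ?U X" "?U (X - {{x, y}}) = ?U X" by auto
  qed
  have bE: "?E (\<lambda>X. edge_ind X j k * (1 / (?U X + 1) ^ 4)) = p * E4"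
    unfolding edge_ind_def E4_def
    using V d by (intro subset_exp_ind_mult) (auto simp: doubleton_in_vertex_pairs Uflip)
  have cE: "?E (\<lambda>X. edge_ind X i l * (1 / (?U X + 1) ^ 4)) = p * E4"
    unfolding edge_ind_def E4_def
    using V d by (intro subset_exp_ind_mult) (auto simp: doubleton_in_vertex_pairs Uflip)
  have sE: "?E (\<lambda>X. ?C X * (1 / (?U X + 1) ^ 5)) \<le> p * E4"
  proof -
    have 1: "?E (\<lambda>X. ?U X * (1 / (?U X + 1) ^ 5)) \<le> E4"
      unfolding E4_def
    proof (rule subset_exp_mono)
      fix X
      have u: "?U X \<ge> 0" by (rule union_on_nonneg)
      then have "?U X * (1 / (?U X + 1) ^ 5) \<le> (?U X + 1) * (1 / (?U X + 1) ^ 5)"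
        by (intro mult_right_mono) auto
      also have "\<dots> = 1 / (?U X + 1) ^ 4" using u by (simp add: eval_nat_numeral)
      finally show "?U X * (1 / (?U X + 1) ^ 5) \<le> 1 / (?U X + 1) ^ 4" .
    qed (use p in auto)
    have "?E (\<lambda>X. ?C X * (1 / (?U X + 1) ^ 5)) = r * ?E (\<lambda>X. ?U X * (1 / (?U X + 1) ^ 5))"
      unfolding r_def using p by (intro subset_exp_common_on' K ij) auto
    also have "\<dots> \<le> p * E4" using 1 r p E40 by (intro mult_mono subset_exp_nonneg) (auto simp: union_on_nonneg)
    finally show ?thesis .
  qed
  have pE: "?E (\<lambda>X. 1 / (?U X + 1) ^ 5) \<le> E4"
    unfolding E4_def
  proof (rule subset_exp_mono)
    fix X
    have u: "?U X \<ge> 0" by (rule union_on_nonneg)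
    then show "1 / (?U X + 1) ^ 5 \<le> 1 / (?U X + 1) ^ 4"
      by (intro divide_left_mono power_increasing mult_pos_pos) auto
  qed (use p in auto)
  have "?E (\<lambda>X. (flip_diff {j, l} (flip_diff {i, k} (pair_jaccard n p i j)) X)\<^sup>2) \<le>
     ?E (\<lambda>X. 3 * (edge_ind X j k * (1 / (?U X + 1) ^ 4)) + 3 * (edge_ind X i l * (1 / (?U X + 1) ^ 4))
     + (27 * (?C X * (1 / (?U X + 1) ^ 5)) + 9 * p * (1 / (?U X + 1) ^ 5)))"
    using p pw by (intro subset_exp_mono) auto
  also have "\<dots> = 3 * (p * E4) + 3 * (p * E4) + (27 * ?E (\<lambda>X. ?C X * (1 / (?U X + 1) ^ 5)) + 9 * p * ?E (\<lambda>X. 1 / (?U X + 1) ^ 5))"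
    by (simp only: subset_exp_add subset_exp_cmult bE cE)
  also have "\<dots> \<le> 3 * (p * E4) + 3 * (p * E4) + (27 * (p * E4) + 9 * p * E4)"
    using sE pE p by (intro add_mono mult_left_mono order_refl) auto
  \<comment> \<open>42 = 3 + 3 + 27 + 9; with 4! = 24 from the inverse fourth moment this gives
    1008.\<close>
  also have "\<dots> = 42 * p * E4" by simp
  also have "\<dots> \<le> 42 * p * (24 / (real (n - 3) * p) ^ 4)" using E4 p by (intro mult_left_mono) auto
  finally show ?thesis by simp
qed

lemma subset_exp_degree_on_square_mult_le:
  assumes p: "0 \<le> p" "p \<le> 1" and W: "W \<subseteq> {1..n} - {b}" "b \<in> {1..n}"
    and G0: "\<And>X. 0 \<le> G X"
    and G: "\<And>k X. k \<in> W \<Longrightarrow> G (insert {b, k} X) = G X" "\<And>k X. k \<in> W \<Longrightarrow> G (X - {{b, k}}) = G X"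
  shows "subset_exp p (vertex_pairs n) (\<lambda>X. (degree_on W b X)\<^sup>2 * G X)
    \<le> ((real n * p)\<^sup>2 + real n * p) * subset_exp p (vertex_pairs n) G"
proof -
  let ?L = "(\<lambda>k. {b, k}) ` W"
  have inj: "inj_on (\<lambda>k. {b, k}) W" by (auto simp: inj_on_def doubleton_eq_iff)
  have deg: "degree_on W b X = (\<Sum>x\<in>?L. of_bool (x \<in> X))" for X
    by (simp add: degree_on_def edge_ind_def sum.reindex[OF inj])
  have "card W \<le> card {1..n}" using W by (intro card_mono) auto
  then have card: "real (card ?L) \<le> real n" by (simp add: card_image[OF inj])
  have "subset_exp p (vertex_pairs n) (\<lambda>X. (degree_on W b X)\<^sup>2 * G X)
    \<le> ((real (card ?L) * p)\<^sup>2 + real (card ?L) * p) * subset_exp p (vertex_pairs n) G"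
    unfolding deg using W G0 G
    by (intro subset_exp_sum_square_mult_le p) (auto simp: doubleton_in_vertex_pairs)
  also have "\<dots> \<le> ((real n * p)\<^sup>2 + real n * p) * subset_exp p (vertex_pairs n) G"
    using card p G0 by (intro mult_right_mono add_mono power_mono subset_exp_nonneg) auto
  finally show ?thesis .
qed

lemma subset_exp_flip_diff2_avg_jaccard_disjoint_le:
  assumes V: "{a, b, c, d} \<subseteq> {1..n}" and d: "distinct [a, b, c, d]" and p: "0 < p" "p \<le> 1"
  shows "subset_exp p (vertex_pairs n) (\<lambda>X. (flip_diff {c, d} (flip_diff {a, b} (avg_jaccard n p)) X)\<^sup>2)
    \<le> (2 / (real n * (real n - 1)))\<^sup>2 * (16128 * p / (real (n - 3) * p) ^ 4)"
proof -
  let ?E = "subset_exp p (vertex_pairs n)"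
  let ?c = "2 / (real n * (real n - 1))"
  define h where "h x y X = flip_diff {c, d} (flip_diff {a, b} (pair_jaccard n p x y)) X" for x y X
  define M where "M = 1008 * p / (real (n - 3) * p) ^ 4"
  \<comment> \<open>Relabelling brings each of the four indices into the form of the single-index
    bound.\<close>
  have swap: "{c, d} = {d, c}" "{a, b} = {b, a}" by auto
  have "?E (\<lambda>X. (h a c X)\<^sup>2) \<le> M" unfolding h_def M_def
    using V d by (intro subset_exp_flip_diff2_pair_jaccard_le p) auto
  moreover have "?E (\<lambda>X. (h a d X)\<^sup>2) \<le> M" unfolding h_def M_def swap(1)
    using V d by (intro subset_exp_flip_diff2_pair_jaccard_le p) auto
  moreover have "?E (\<lambda>X. (h b c X)\<^sup>2) \<le> M" unfolding h_def M_def swap(2)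
    using V d by (intro subset_exp_flip_diff2_pair_jaccard_le p) auto
  moreover have "?E (\<lambda>X. (h b d X)\<^sup>2) \<le> M" unfolding h_def M_def swap
    using V d by (intro subset_exp_flip_diff2_pair_jaccard_le p) auto
  ultimately have M: "?E (\<lambda>X. (h a c X)\<^sup>2 + (h a d X)\<^sup>2 + (h b c X)\<^sup>2 + (h b d X)\<^sup>2) \<le> 4 * M"
    by (simp add: subset_exp_add)
  have "?E (\<lambda>X. (flip_diff {c, d} (flip_diff {a, b} (avg_jaccard n p)) X)\<^sup>2) =
      ?E (\<lambda>X. ?c\<^sup>2 * (h a c X + h a d X + h b c X + h b d X)\<^sup>2)"
    unfolding flip_diff2_avg_jaccard_disjoint[OF V d] h_def power_mult_distrib ..
  also have "\<dots> \<le> ?E (\<lambda>X. ?c\<^sup>2 * (4 * ((h a c X)\<^sup>2 + (h a d X)\<^sup>2 + (h b c X)\<^sup>2 + (h b d X)\<^sup>2)))"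
    using p by (intro subset_exp_mono mult_left_mono four_squares_le) auto
  also have "\<dots> = ?c\<^sup>2 * (4 * ?E (\<lambda>X. (h a c X)\<^sup>2 + (h a d X)\<^sup>2 + (h b c X)\<^sup>2 + (h b d X)\<^sup>2))"
    by (simp only: subset_exp_cmult)
  \<comment> \<open>Four squares, each at most M, and a factor 4 for squaring a sum of four terms:
    16 * 1008 = 16128.\<close>
  also have "\<dots> \<le> ?c\<^sup>2 * (4 * (4 * M))" using M by (intro mult_left_mono) auto
  finally show ?thesis by (simp add: M_def)
qed

text \<open>The n - 3 differences at pairs {a,j} are first summed over \<open>j\<close> for a fixed
  graph, which turns indicators into degrees of \<open>b\<close> and \<open>c\<close> and common
  neighbour counts into a count of paths of length two from \<open>a\<close>. Squares are taken only
  afterwards.\<close>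

lemma subset_exp_flip_diff2_avg_jaccard_adjacent_le:
  assumes V: "{a, b, c} \<subseteq> {1..n}" and d: "distinct [a, b, c]" and p: "0 < p" "p \<le> 1"
  shows "subset_exp p (vertex_pairs n) (\<lambda>X. (flip_diff {a, c} (flip_diff {a, b} (avg_jaccard n p)) X)\<^sup>2)
    \<le> (2 / (real n * (real n - 1)))\<^sup>2 *
      (5 * (16128 * ((real n * p)\<^sup>2 + real n * p) / (real (n - 2) * p) ^ 4 + 8 / (real (n - 2) * p)\<^sup>2))"
proof -
  let ?E = "subset_exp p (vertex_pairs n)"
  let ?c = "2 / (real n * (real n - 1))"
  define W where "W = {1..n} - {a, b, c}"
  define L where "L = (real n * p)\<^sup>2 + real n * p"
  define r where "r = p / (2 - p)"
  have r: "0 \<le> r" "r \<le> p" using p mult_left_mono[of 1 "2 - p" p] by (auto simp: r_def field_simps)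
  have finW: "finite W" "a \<notin> W" "b \<notin> W" "c \<notin> W" by (auto simp: W_def)
  have abc: "a \<in> {1..n}" "b \<in> {1..n}" "c \<in> {1..n}" "a \<noteq> b" "a \<noteq> c" "b \<noteq> c" using V d by auto
  have card: "Suc (card W) = n - 2"
  proof -
    have "card {a, b, c} = 3" using d by simp
    moreover have "card {a, b, c} \<le> card {1..n}" using V by (intro card_mono) auto
    moreover have "card W = card {1..n} - card {a, b, c}"
      unfolding W_def using V by (intro card_Diff_subset) auto
    ultimately show ?thesis by simp
  qed
  have cardn: "real (card W) \<le> real n"
    using card_mono[of "{1..n}" W] by (simp add: W_def)
  \<comment> \<open>The degree of the shared vertex serves as a lower bound, up to a factor 2, for
    the denominators of all \<open>j\<close> at once. It is independent of every edge avoiding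
    \<open>a\<close>.\<close>
  define \<delta> where "\<delta> = degree_on W a"
  have \<delta>0: "0 \<le> \<delta> X" for X unfolding \<delta>_def by (rule degree_on_nonneg)
  have \<delta>1: "0 < \<delta> X + 1" for X using \<delta>0[of X] by linarith
  define E4 where "E4 = ?E (\<lambda>X. 1 / (\<delta> X + 1) ^ 4)"
  have "W \<subseteq> {1..n} - {a}" by (auto simp: W_def)
  from subset_exp_degree_on_inverse_power[OF this abc(1) p, of 4]
  have E4: "E4 \<le> 24 / (real (n - 2) * p) ^ 4"
    unfolding card E4_def \<delta>_def by (simp add: fact_numeral)
  have E40: "0 \<le> E4" unfolding E4_def using p \<delta>1 by (intro subset_exp_nonneg) (auto simp: less_imp_le)
  have L0: "0 \<le> L" unfolding L_def using p by simp
  define D where "D k = degree_on (W - {k}) k" for k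
  define C where "C X = (\<Sum>k\<in>W. edge_ind X a k * D k X)" for X
  define h where "h j X = flip_diff {a, c} (flip_diff {a, b} (pair_jaccard n p a j)) X" for j X
  define H where "H X = flip_diff {a, c} (flip_diff {a, b} (pair_jaccard n p b c)) X" for X
  define U where "U = union_on W b c"
  define x1 x2 x3 x4 x5 where "x1 X = 4 * degree_on W b X / (\<delta> X + 1)\<^sup>2"
    and "x2 X = 4 * degree_on W c X / (\<delta> X + 1)\<^sup>2"
    and "x3 X = 24 * C X / (\<delta> X + 1) ^ 3" and "x4 X = 8 * real n * p / (\<delta> X + 1) ^ 3"
    and "x5 X = 2 / (U X + 1)" for X
  have hj: "\<bar>h j X\<bar> \<le> 4 * (edge_ind X b j + edge_ind X c j) / (\<delta> X + 1)\<^sup>2 +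
      8 * (3 * common_on (W - {j}) a j X + p) / (\<delta> X + 1) ^ 3" if j: "j \<in> W" for j X
  proof -
    define K where "K = W - {j}"
    have K: "finite K" "a \<notin> K" "j \<notin> K" "b \<notin> K" "c \<notin> K" using finW by (auto simp: K_def)
    have dist: "distinct [a, j, b, c]" using j finW abc by auto
    have W': "{1..n} - {a, j} = insert b (insert c K)" using j V d by (auto simp: K_def W_def)
    define s t where "s = common_on K a j X" and "t = union_on K a j X"
    obtain m where m: "t = real m" using union_on_nat[of K a j X] t_def by blast
    have s: "0 \<le> s" "s \<le> t" unfolding s_def t_def by (rule common_on_nonneg common_on_le_union_on)+
    have "W = insert j K" using j by (auto simp: K_def)
    then have "\<delta> X = edge_ind X a j + degree_on K a X" using K by (simp add: \<delta>_def)
    moreover have "degree_on K a X \<le> t" unfolding t_def by (rule degree_on_le_union_on)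
    ultimately have "\<delta> X \<le> 1 + t" by (simp only: add_mono edge_ind_le_1)
    \<comment> \<open>Leaving out \<open>j\<close> costs the degree at most 1, so \<delta> + 1 <= t
      + 2 <= 2 (t + 1).\<close>
    then have t: "(\<delta> X + 1) / 2 \<le> t + 1" using s by simp
    have inv: "1 / (t + 1) ^ q \<le> 2 ^ q / (\<delta> X + 1) ^ q" for q
    proof -
      have "1 / (t + 1) ^ q \<le> 1 / ((\<delta> X + 1) / 2) ^ q"
        using t \<delta>1[of X] s by (intro divide_left_mono power_mono mult_pos_pos zero_less_power) auto
      then show ?thesis by (simp add: power_divide)
    qed
    have "\<bar>h j X\<bar> = \<bar>mixed_diff r (edge_ind X j b) (edge_ind X j c) s t\<bar>"
      unfolding h_def pair_jaccard_def W' s_def t_def r_def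
      using K dist by (subst flip_diff2_jaccard_on_adjacent) auto
    also have "\<dots> \<le> (edge_ind X j b + edge_ind X j c) / (t + 1)\<^sup>2 + (3 * s + p) / (t + 1) ^ 3"
      by (rule abs_mixed_diff_le[OF edge_ind_01 edge_ind_01 s m r])
    also have "\<dots> = (edge_ind X b j + edge_ind X c j) * (1 / (t + 1)\<^sup>2) + (3 * s + p) * (1 / (t + 1) ^ 3)"
      by (simp add: edge_ind_sym[of X j])
    also have "\<dots> \<le> (edge_ind X b j + edge_ind X c j) * (2\<^sup>2 / (\<delta> X + 1)\<^sup>2) + (3 * s + p) * (2 ^ 3 / (\<delta> X + 1) ^ 3)"
      using s p by (intro add_mono mult_left_mono inv) auto
    finally show ?thesis by (simp add: s_def K_def mult.commute)
  qed
  \<comment> \<open>Double counting of the paths a - k - j inside \<open>W\<close>, grouped by the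
    middle vertex \<open>k\<close>.\<close>
  have C: "(\<Sum>j\<in>W. common_on (W - {j}) a j X) = C X" for X
  proof -
    have off: "(\<Sum>k\<in>W - {j}. f k) = (\<Sum>k\<in>W. if k \<noteq> j then f k else 0)" for j and f :: "nat \<Rightarrow> real"
      by (rule sum.mono_neutral_cong_left) (use finW in auto)
    have "(\<Sum>j\<in>W. common_on (W - {j}) a j X) =
        (\<Sum>j\<in>W. \<Sum>k\<in>W. if k \<noteq> j then edge_ind X a k * edge_ind X j k else 0)"
      unfolding common_on_def off ..
    also have "\<dots> = (\<Sum>k\<in>W. \<Sum>j\<in>W. if k \<noteq> j then edge_ind X a k * edge_ind X j k else 0)"
      by (rule sum.swap)
    also have "\<dots> = C X"
      unfolding C_def D_def degree_on_def sum_distrib_left off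
      by (intro sum.cong refl) (auto simp: edge_ind_sym)
    finally show ?thesis .
  qed
  have pw: "(flip_diff {a, c} (flip_diff {a, b} (avg_jaccard n p)) X)\<^sup>2 \<le>
    ?c\<^sup>2 * (5 * ((x1 X)\<^sup>2 + (x2 X)\<^sup>2 + (x3 X)\<^sup>2 + (x4 X)\<^sup>2 + (x5 X)\<^sup>2))" for X
  proof -
    have "\<bar>\<Sum>j\<in>W. h j X\<bar> \<le> (\<Sum>j\<in>W. 4 * (edge_ind X b j + edge_ind X c j) / (\<delta> X + 1)\<^sup>2 +
        8 * (3 * common_on (W - {j}) a j X + p) / (\<delta> X + 1) ^ 3)"
      by (intro order_trans[OF sum_abs] sum_mono hj)
    also have "\<dots> = 4 * (degree_on W b X + degree_on W c X) / (\<delta> X + 1)\<^sup>2 +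
        8 * (3 * C X + real (card W) * p) / (\<delta> X + 1) ^ 3"
      unfolding C[symmetric] degree_on_def
      by (simp add: sum.distrib sum_distrib_left sum_divide_distrib[symmetric] flip: sum_distrib_left)
    also have "\<dots> \<le> 4 * (degree_on W b X + degree_on W c X) / (\<delta> X + 1)\<^sup>2 +
        8 * (3 * C X + real n * p) / (\<delta> X + 1) ^ 3"
      using cardn p \<delta>1[of X]
      by (intro add_mono divide_right_mono mult_left_mono mult_right_mono) (auto simp: less_imp_le)
    also have "\<dots> = x1 X + x2 X + x3 X + x4 X"
      by (simp add: x1_def x2_def x3_def x4_def add_divide_distrib distrib_left)
    finally have 1: "\<bar>\<Sum>j\<in>W. h j X\<bar> \<le> x1 X + x2 X + x3 X + x4 X" .
    have 2: "\<bar>H X\<bar> \<le> x5 X"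
    proof -
      have W': "{1..n} - {b, c} = insert a W" using V d by (auto simp: W_def)
      have "H X = flip_diff {c, a} (flip_diff {b, a} (pair_jaccard n p b c)) X"
        by (simp add: H_def insert_commute)
      also have "\<bar>\<dots>\<bar> \<le> x5 X"
        unfolding pair_jaccard_def W' x5_def U_def r_def[symmetric]
        by (subst flip_diff2_jaccard_on_common; (rule abs_double_edge_diff_le)?)
           (use finW abc r p in \<open>auto intro: common_on_nonneg common_on_le_union_on\<close>)
      finally show ?thesis .
    qed
    have "\<bar>(\<Sum>j\<in>W. h j X) + H X\<bar> \<le> x1 X + x2 X + x3 X + x4 X + x5 X"
      using 1 2 by linarith
    then have "((\<Sum>j\<in>W. h j X) + H X)\<^sup>2 \<le> (x1 X + x2 X + x3 X + x4 X + x5 X)\<^sup>2"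
      by (rule abs_le_square_iff[THEN iffD1, OF order_trans[OF _ abs_ge_self]])
    also have "\<dots> \<le> 5 * ((x1 X)\<^sup>2 + (x2 X)\<^sup>2 + (x3 X)\<^sup>2 + (x4 X)\<^sup>2 + (x5 X)\<^sup>2)"
      by (rule five_squares_le)
    finally have "?c\<^sup>2 * ((\<Sum>j\<in>W. h j X) + H X)\<^sup>2 \<le>
        ?c\<^sup>2 * (5 * ((x1 X)\<^sup>2 + (x2 X)\<^sup>2 + (x3 X)\<^sup>2 + (x4 X)\<^sup>2 + (x5 X)\<^sup>2))"
      by (intro mult_left_mono) auto
    then show ?thesis
      unfolding flip_diff2_avg_jaccard_adjacent[OF V d] h_def H_def W_def power_mult_distrib .
  qed
  \<comment> \<open>The edges from \<open>b\<close> or \<open>c\<close> into \<open>W\<close> are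
    independent of those counted by \<delta>, so the squared degree splits off.\<close>
  have deg: "?E (\<lambda>X. (4 * degree_on W x X / (\<delta> X + 1)\<^sup>2)\<^sup>2) \<le> 16 * L * E4" if x: "x = b \<or> x = c" for x
  proof -
    have "?E (\<lambda>X. (4 * degree_on W x X / (\<delta> X + 1)\<^sup>2)\<^sup>2) = ?E (\<lambda>X. 16 * ((degree_on W x X)\<^sup>2 * (1 / (\<delta> X + 1) ^ 4)))"
      by (simp add: power_divide power_mult_distrib flip: power_mult)
    also have "\<dots> = 16 * ?E (\<lambda>X. (degree_on W x X)\<^sup>2 * (1 / (\<delta> X + 1) ^ 4))"
      by (rule subset_exp_cmult)
    also have "?E (\<lambda>X. (degree_on W x X)\<^sup>2 * (1 / (\<delta> X + 1) ^ 4)) \<le> L * E4"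
      unfolding L_def E4_def
    proof (rule subset_exp_degree_on_square_mult_le)
      fix k X assume "k \<in> W"
      then have "{x, k} \<noteq> {a, k'}" if "k' \<in> W" for k'
        using that x abc finW by (auto simp: doubleton_eq_iff)
      then have "\<delta> (insert {x, k} X) = \<delta> X" "\<delta> (X - {{x, k}}) = \<delta> X"
        unfolding \<delta>_def by auto
      then show "1 / (\<delta> (insert {x, k} X) + 1) ^ 4 = 1 / (\<delta> X + 1) ^ 4"
        "1 / (\<delta> (X - {{x, k}}) + 1) ^ 4 = 1 / (\<delta> X + 1) ^ 4" by simp_all
    qed (use p x abc \<delta>1 in \<open>auto simp: W_def less_imp_le\<close>)
    finally show ?thesis by simp
  qed
  have e3: "?E (\<lambda>X. (x3 X)\<^sup>2) \<le> 576 * L * E4"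
  proof -
    \<comment> \<open>Cauchy-Schwarz, with the indicator of {a,k} as weight, bounds the squared path
      count by \<delta> times the sum of D_k^2 over the neighbours \<open>k\<close> of
      \<open>a\<close>. Each D_k is independent of the edges at \<open>a\<close>, and the weights
      \<open>G k\<close> add up to \<delta>^2 / (\<delta> + 1)^6.\<close>
    define G where "G k X = \<delta> X * edge_ind X a k * (1 / (\<delta> X + 1) ^ 6)" for k X
    have G0: "0 \<le> G k X" for k X
      unfolding G_def using \<delta>0[of X] by simp
    have CS: "(x3 X)\<^sup>2 \<le> 576 * (\<Sum>k\<in>W. (D k X)\<^sup>2 * G k X)" for X
    proof -
      have sq: "(edge_ind X a k)\<^sup>2 = edge_ind X a k" for k by (simp add: edge_ind_def)
      have "C X = (\<Sum>k\<in>W. edge_ind X a k * (edge_ind X a k * D k X))"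
        unfolding C_def mult.assoc[symmetric] power2_eq_square[symmetric] sq ..
      then have "(C X)\<^sup>2 \<le> (\<Sum>k\<in>W. (edge_ind X a k)\<^sup>2) * (\<Sum>k\<in>W. (edge_ind X a k * D k X)\<^sup>2)"
        by (simp only: Cauchy_Schwarz_ineq_sum)
      also have "\<dots> = (\<Sum>k\<in>W. \<delta> X * edge_ind X a k * (D k X)\<^sup>2)"
        by (simp add: power_mult_distrib sq \<delta>_def degree_on_def sum_distrib_left mult.assoc)
      finally have "(C X)\<^sup>2 * (1 / (\<delta> X + 1) ^ 6) \<le> (\<Sum>k\<in>W. \<delta> X * edge_ind X a k * (D k X)\<^sup>2) * (1 / (\<delta> X + 1) ^ 6)"
        using \<delta>1[of X] by (intro mult_right_mono) (auto simp: less_imp_le)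
      also have "\<dots> = (\<Sum>k\<in>W. (D k X)\<^sup>2 * G k X)"
        unfolding G_def sum_distrib_right by (intro sum.cong) (simp_all only: mult_ac)
      finally show ?thesis
        by (simp add: x3_def power_divide power_mult_distrib flip: power_mult)
    qed
    have "?E (\<lambda>X. (x3 X)\<^sup>2) \<le> ?E (\<lambda>X. 576 * (\<Sum>k\<in>W. (D k X)\<^sup>2 * G k X))"
      using p CS by (intro subset_exp_mono) auto
    also have "\<dots> = 576 * (\<Sum>k\<in>W. ?E (\<lambda>X. (D k X)\<^sup>2 * G k X))"
      by (simp only: subset_exp_cmult subset_exp_sum)
    also have "(\<Sum>k\<in>W. ?E (\<lambda>X. (D k X)\<^sup>2 * G k X)) \<le> (\<Sum>k\<in>W. L * ?E (G k))"
      unfolding L_def D_def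
    proof (intro sum_mono subset_exp_degree_on_square_mult_le)
      fix k j X assume kj: "k \<in> W" "j \<in> W - {k}"
      then have "{k, j} \<noteq> {a, k'}" for k' using finW by (auto simp: doubleton_eq_iff)
      then have "\<delta> (insert {k, j} X) = \<delta> X" "\<delta> (X - {{k, j}}) = \<delta> X"
        "edge_ind (insert {k, j} X) a k = edge_ind X a k" "edge_ind (X - {{k, j}}) a k = edge_ind X a k"
        using kj finW unfolding \<delta>_def by (auto simp: edge_ind_insert edge_ind_delete)
      then show "G k (insert {k, j} X) = G k X" "G k (X - {{k, j}}) = G k X"
        unfolding G_def by simp_all
    qed (use p G0 in \<open>auto simp: W_def\<close>)
    also have "(\<Sum>k\<in>W. L * ?E (G k)) = L * ?E (\<lambda>X. \<Sum>k\<in>W. G k X)"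
      by (simp only: subset_exp_sum sum_distrib_left)
    also have "?E (\<lambda>X. \<Sum>k\<in>W. G k X) \<le> E4"
      unfolding E4_def
    proof (rule subset_exp_mono)
      fix X
      have "(\<Sum>k\<in>W. G k X) = (\<delta> X)\<^sup>2 * (1 / (\<delta> X + 1) ^ 6)"
        unfolding G_def by (simp add: \<delta>_def degree_on_def power2_eq_square flip: sum_distrib_left sum_divide_distrib)
      also have "\<dots> \<le> (\<delta> X + 1)\<^sup>2 * (1 / (\<delta> X + 1) ^ 6)"
        using \<delta>0[of X] by (intro mult_right_mono power_mono) auto
      also have "\<dots> = 1 / (\<delta> X + 1) ^ 4"
      proof -
        have "(\<delta> X + 1) ^ 6 = (\<delta> X + 1)\<^sup>2 * (\<delta> X + 1) ^ 4" by (simp flip: power_add)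
        moreover have "(\<delta> X + 1)\<^sup>2 \<noteq> 0" using \<delta>1[of X] by simp
        moreover have "x * (1 / (x * z)) = 1 / z" if "x \<noteq> 0" for x z :: real using that by simp
        ultimately show ?thesis by (simp only: simp_thms)
      qed
      finally show "(\<Sum>k\<in>W. G k X) \<le> 1 / (\<delta> X + 1) ^ 4" .
    qed (use p in auto)
    finally show ?thesis using L0 by (simp add: mult_left_mono)
  qed
  have e4: "?E (\<lambda>X. (x4 X)\<^sup>2) \<le> 64 * L * E4"
  proof -
    have "?E (\<lambda>X. (x4 X)\<^sup>2) \<le> ?E (\<lambda>X. 64 * L * (1 / (\<delta> X + 1) ^ 4))"
    proof (rule subset_exp_mono)
      fix X
      have "(x4 X)\<^sup>2 = 64 * (real n * p)\<^sup>2 * (1 / (\<delta> X + 1) ^ 6)"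
        by (simp add: x4_def power_divide power_mult_distrib flip: power_mult)
      also have "\<dots> \<le> 64 * L * (1 / (\<delta> X + 1) ^ 4)"
        using p \<delta>0[of X] unfolding L_def
        by (intro mult_mono divide_left_mono power_increasing mult_pos_pos zero_less_power) auto
      finally show "(x4 X)\<^sup>2 \<le> 64 * L * (1 / (\<delta> X + 1) ^ 4)" .
    qed (use p in auto)
    then show ?thesis by (simp only: subset_exp_cmult E4_def)
  qed
  have e5: "?E (\<lambda>X. (x5 X)\<^sup>2) \<le> 8 / (real (n - 2) * p)\<^sup>2"
  proof -
    have "(\<lambda>X. (x5 X)\<^sup>2) = (\<lambda>X. 4 * (1 / (U X + 1)\<^sup>2))" by (simp add: x5_def power_divide)
    then have "?E (\<lambda>X. (x5 X)\<^sup>2) = 4 * ?E (\<lambda>X. 1 / (U X + 1)\<^sup>2)" by (simp only: subset_exp_cmult)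
    also have "?E (\<lambda>X. 1 / (U X + 1)\<^sup>2) \<le> fact 2 / (real (Suc (card W)) * p)\<^sup>2"
      unfolding U_def using abc p by (intro subset_exp_union_on_inverse_power) (auto simp: W_def)
    finally show ?thesis unfolding card by simp
  qed
  have "?E (\<lambda>X. (flip_diff {a, c} (flip_diff {a, b} (avg_jaccard n p)) X)\<^sup>2) \<le>
     ?E (\<lambda>X. ?c\<^sup>2 * (5 * ((x1 X)\<^sup>2 + (x2 X)\<^sup>2 + (x3 X)\<^sup>2 + (x4 X)\<^sup>2 + (x5 X)\<^sup>2)))"
    using p pw by (intro subset_exp_mono) auto
  also have "\<dots> = ?c\<^sup>2 * (5 * (?E (\<lambda>X. (x1 X)\<^sup>2) + ?E (\<lambda>X. (x2 X)\<^sup>2) + ?E (\<lambda>X. (x3 X)\<^sup>2) + ?E (\<lambda>X. (x4 X)\<^sup>2) + ?E (\<lambda>X. (x5 X)\<^sup>2)))"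
    by (simp only: subset_exp_cmult subset_exp_add)
  also have "\<dots> \<le> ?c\<^sup>2 * (5 * (16 * L * E4 + 16 * L * E4 + 576 * L * E4 + 64 * L * E4 + 8 / (real (n - 2) * p)\<^sup>2))"
    using deg[of b] deg[of c] e3 e4 e5 unfolding x1_def x2_def by (intro mult_left_mono add_mono) auto
  \<comment> \<open>672 = 16 + 16 + 576 + 64, where 576 = 24^2 and 64 = 8^2; multiplied by 4! it
    becomes 16128.\<close>
  also have "\<dots> = ?c\<^sup>2 * (5 * (672 * (L * E4) + 8 / (real (n - 2) * p)\<^sup>2))" by simp
  also have "\<dots> \<le> ?c\<^sup>2 * (5 * (672 * (L * (24 / (real (n - 2) * p) ^ 4)) + 8 / (real (n - 2) * p)\<^sup>2))"
    using E4 L0 by (intro mult_left_mono add_mono) auto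
  finally show ?thesis by (simp add: L_def mult_ac)
qed

lemma subset_exp_avg_jaccard:
  assumes "2 \<le> n" "p \<le> 1"
  shows "subset_exp p (vertex_pairs n) (avg_jaccard n p) = p / (2 - p)"
proof -
  let ?E = "subset_exp p (vertex_pairs n)"
  have "?E (avg_jaccard n p) =
     1 / (real n * (real n - 1)) * (\<Sum>i\<in>{1..n}. \<Sum>j\<in>{1..n} - {i}. ?E (pair_jaccard n p i j))"
    unfolding avg_jaccard_eq subset_exp_cmult subset_exp_sum ..
  also have "(\<Sum>i\<in>{1..n}. \<Sum>j\<in>{1..n} - {i}. ?E (pair_jaccard n p i j)) =
     (\<Sum>i\<in>{1..n}. \<Sum>j\<in>{1..n} - {i}. p / (2 - p))"
    unfolding pair_jaccard_def using assms by (intro sum.cong refl subset_exp_jaccard_on) auto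
  also have "\<dots> = real n * (real n - 1) * (p / (2 - p))"
    using assms by (simp add: of_nat_diff)
  finally show ?thesis using assms by simp
qed

text \<open>All 2 (n - 2) affected indices have the same expected derivative, whose denominator n -
  2 cancels against their number. The result does not depend on \<open>e\<close>, as the
  second-order inequality demands.\<close>

lemma subset_exp_flip_diff_avg_jaccard:
  assumes "3 \<le> n" "0 < p" "p \<le> 1" "e \<in> vertex_pairs n"
  shows "subset_exp p (vertex_pairs n) (flip_diff e (avg_jaccard n p)) =
    4 * (1 - (1 - p) ^ (2 * (n - 2))) / (real n * (real n - 1) * (2 - p)\<^sup>2)"
proof -
  let ?E = "subset_exp p (vertex_pairs n)"
  from assms(4) obtain a b where e: "e = {a, b}" "a \<noteq> b" "a \<in> {1..n}" "b \<in> {1..n}"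
    by (rule vertex_pairsE)
  define v where "v = (1 - (1 - p) ^ (2 * (n - 2))) / (real (n - 2) * (2 - p)\<^sup>2)"
  have v: "?E (flip_diff {x, y} (pair_jaccard n p x j)) = v"
    if xy: "x \<noteq> y" "x \<in> {1..n}" "y \<in> {1..n}" and j: "j \<in> {1..n} - {x, y}" for x y j
  proof -
    define K where "K = {1..n} - {x, j, y}"
    have "{1..n} - {x, j} = insert y K" using xy j by (auto simp: K_def)
    moreover have "card K = n - 3"
    proof -
      have "card {x, j, y} = 3" using xy j by auto
      moreover have "card K = card {1..n} - card {x, j, y}"
        unfolding K_def using xy j by (intro card_Diff_subset) auto
      ultimately show ?thesis by simp
    qed
    moreover have "Suc (n - 3) = n - 2" using assms(1) by simp
    ultimately show ?thesis
      using subset_exp_flip_diff_jaccard_on[of K n x j y p] xy j assms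
      unfolding pair_jaccard_def v_def by (auto simp: K_def)
  qed
  have card: "card ({1..n} - {a, b}) = n - 2"
    using e by (subst card_Diff_subset) auto
  have "?E (flip_diff e (avg_jaccard n p)) = 2 / (real n * (real n - 1)) *
     (\<Sum>j\<in>{1..n} - {a, b}. ?E (flip_diff {a, b} (pair_jaccard n p a j)) + ?E (flip_diff {a, b} (pair_jaccard n p b j)))"
  proof -
    have "flip_diff e (avg_jaccard n p) = (\<lambda>X. 2 / (real n * (real n - 1)) *
      (\<Sum>j\<in>{1..n} - {a, b}. flip_diff {a, b} (pair_jaccard n p a j) X + flip_diff {a, b} (pair_jaccard n p b j) X))"
      using flip_diff_avg_jaccard[OF e(3,4,2)] e(1) by blast
    then show ?thesis by (simp only: subset_exp_cmult subset_exp_sum subset_exp_add)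
  qed
  also have "(\<Sum>j\<in>{1..n} - {a, b}. ?E (flip_diff {a, b} (pair_jaccard n p a j)) + ?E (flip_diff {a, b} (pair_jaccard n p b j)))
     = (\<Sum>j\<in>{1..n} - {a, b}. v + v)"
  proof (rule sum.cong[OF refl])
    fix j assume "j \<in> {1..n} - {a, b}"
    then show "?E (flip_diff {a, b} (pair_jaccard n p a j)) + ?E (flip_diff {a, b} (pair_jaccard n p b j)) = v + v"
      using v[of a b j] v[of b a j] e by (simp add: insert_commute)
  qed
  also have "\<dots> = real (n - 2) * (2 * v)" by (simp only: sum_constant card) simp
  also have "2 / (real n * (real n - 1)) * (real (n - 2) * (2 * v)) =
      4 * (1 - (1 - p) ^ (2 * (n - 2))) / (real n * (real n - 1) * (2 - p)\<^sup>2)"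
  proof -
    have "real (n - 2) * v = (1 - (1 - p) ^ (2 * (n - 2))) / (2 - p)\<^sup>2"
      using assms unfolding v_def by simp
    then show ?thesis by (simp add: mult.left_commute[of "real (n - 2)"])
  qed
  finally show ?thesis .
qed

lemma sum_flip_diff2_avg_jaccard_le:
  assumes n: "6 \<le> n" and p: "0 < p" "p \<le> 1" and x: "1 \<le> real n * p"
  defines "N \<equiv> real n * (real n - 1) / 2"
  shows "(\<Sum>e\<in>vertex_pairs n. \<Sum>f\<in>vertex_pairs n - {e}.
      subset_exp p (vertex_pairs n) (\<lambda>X. (flip_diff f (flip_diff e (avg_jaccard n p)) X)\<^sup>2))
    \<le> (1 / N) * (2 * real n * (2580640 / (real n * p)\<^sup>2) + N * (258048 * p / (real n * p) ^ 4))"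
proof -
  let ?V = "vertex_pairs n"
  define T where "T e f = subset_exp p ?V (\<lambda>X. (flip_diff f (flip_diff e (avg_jaccard n p)) X)\<^sup>2)" for e f
  define A where "A = 2580640 / (real n * p)\<^sup>2"
  define B where "B = 258048 * p / (real n * p) ^ 4"
  have N: "0 < N" using n by (simp add: N_def)
  have cN: "real (card ?V) = N" unfolding N_def by (rule card_vertex_pairs)
  have c: "2 / (real n * (real n - 1)) = 1 / N" by (simp add: N_def)
  have AB: "0 \<le> A" "0 \<le> B" using p by (auto simp: A_def B_def)
  define x where "x = real n * p"
  have x1: "1 \<le> x" using x by (simp add: x_def)
  \<comment> \<open>From n >= 6 one gets n - 3 >= n / 2.\<close>
  have half: "x / 2 \<le> real (n - 3) * p" "x / 2 \<le> real (n - 2) * p"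
  proof -
    have "real n / 2 * p \<le> real (n - 3) * p" "real n / 2 * p \<le> real (n - 2) * p"
      using n p by (intro mult_right_mono; simp add: of_nat_diff)+
    then show "x / 2 \<le> real (n - 3) * p" "x / 2 \<le> real (n - 2) * p" by (simp_all add: x_def)
  qed
  have inv: "1 / y ^ k \<le> 2 ^ k / x ^ k" if "x / 2 \<le> y" for y k
  proof -
    have "1 / y ^ k \<le> 1 / (x / 2) ^ k"
      using x1 that by (intro divide_left_mono power_mono mult_pos_pos zero_less_power) auto
    then show ?thesis by (simp add: power_divide)
  qed
  have adj: "T e f \<le> (1 / N)\<^sup>2 * A" if ef: "e \<in> ?V" "f \<in> ?V - {e}" "e \<inter> f \<noteq> {}" for e f
  proof -
    from ef obtain a where a: "a \<in> e" "a \<in> f" by auto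
    have "\<exists>b. e = {a, b} \<and> a \<noteq> b \<and> a \<in> {1..n} \<and> b \<in> {1..n}" if "e \<in> ?V" "a \<in> e" for e
      using that by (elim vertex_pairsE) (auto simp: insert_commute)
    with a ef obtain b c where bc: "e = {a, b}" "f = {a, c}" "a \<noteq> b" "a \<noteq> c" "a \<in> {1..n}" "b \<in> {1..n}" "c \<in> {1..n}"
      by (metis DiffD1)
    with ef have "b \<noteq> c" by auto
    then have "T e f \<le> (1 / N)\<^sup>2 * (5 * (16128 * ((real n * p)\<^sup>2 + real n * p) / (real (n - 2) * p) ^ 4 + 8 / (real (n - 2) * p)\<^sup>2))"
      unfolding T_def bc(1,2) c[symmetric]
      using bc by (intro subset_exp_flip_diff2_avg_jaccard_adjacent_le p) auto
    also have "\<dots> \<le> (1 / N)\<^sup>2 * A"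
    proof (intro mult_left_mono)
      have "(x\<^sup>2 + x) * (1 / (real (n - 2) * p) ^ 4) \<le> (2 * x\<^sup>2) * (2 ^ 4 / x ^ 4)"
        using x1 p half by (intro mult_mono inv) (auto simp: power2_eq_square)
      also have "\<dots> = 32 / x\<^sup>2" using x1 by (simp add: divide_simps eval_nat_numeral)
      finally have 1: "(x\<^sup>2 + x) / (real (n - 2) * p) ^ 4 \<le> 32 / x\<^sup>2" by simp
      have 2: "1 / (real (n - 2) * p)\<^sup>2 \<le> 4 / x\<^sup>2" using inv[OF half(2), of 2] by simp
      have "5 * (16128 * (x\<^sup>2 + x) / (real (n - 2) * p) ^ 4 + 8 / (real (n - 2) * p)\<^sup>2) =
         80640 * ((x\<^sup>2 + x) / (real (n - 2) * p) ^ 4) + 40 * (1 / (real (n - 2) * p)\<^sup>2)" by simp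
      also have "\<dots> \<le> 80640 * (32 / x\<^sup>2) + 40 * (4 / x\<^sup>2)" using 1 2 by (intro add_mono mult_left_mono) auto
      \<comment> \<open>80640 = 5 * 16128 and 80640 * 32 + 160 = 2580640; the factor 32 = 2 * 2^4
        uses x^2 + x <= 2 x^2 for x >= 1.\<close>
      also have "\<dots> = A" by (simp add: A_def x_def)
      finally show "5 * (16128 * ((real n * p)\<^sup>2 + real n * p) / (real (n - 2) * p) ^ 4 + 8 / (real (n - 2) * p)\<^sup>2) \<le> A"
        by (simp add: x_def)
    qed auto
    finally show ?thesis .
  qed
  have dis: "T e f \<le> (1 / N)\<^sup>2 * B" if ef: "e \<in> ?V" "f \<in> ?V - {e}" "e \<inter> f = {}" for e f
  proof -
    from ef obtain a b where ab: "e = {a, b}" "a \<noteq> b" "a \<in> {1..n}" "b \<in> {1..n}" by (elim vertex_pairsE)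
    from ef have "f \<in> ?V" by auto
    then obtain c d where cd: "f = {c, d}" "c \<noteq> d" "c \<in> {1..n}" "d \<in> {1..n}" by (elim vertex_pairsE)
    have "T e f \<le> (1 / N)\<^sup>2 * (16128 * p / (real (n - 3) * p) ^ 4)"
      unfolding T_def ab(1) cd(1) c[symmetric]
      using ab cd ef by (intro subset_exp_flip_diff2_avg_jaccard_disjoint_le p) auto
    also have "\<dots> \<le> (1 / N)\<^sup>2 * B"
    proof (intro mult_left_mono)
      have "16128 * p * (1 / (real (n - 3) * p) ^ 4) \<le> 16128 * p * (2 ^ 4 / x ^ 4)"
        using p half by (intro mult_left_mono inv) auto
      then show "16128 * p / (real (n - 3) * p) ^ 4 \<le> B" by (simp add: B_def x_def)
    qed auto
    finally show ?thesis .
  qed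
  have row: "(\<Sum>f\<in>?V - {e}. T e f) \<le> (1 / N)\<^sup>2 * (2 * real n * A + N * B)" if e: "e \<in> ?V" for e
  proof -
    \<comment> \<open>The edges meeting \<open>e\<close> number at most 2 n; for the disjoint ones
      the crude count of all N edges is enough.\<close>
    let ?S = "{f \<in> ?V - {e}. e \<inter> f \<noteq> {}}" and ?R = "{f \<in> ?V - {e}. e \<inter> f = {}}"
    from e obtain a b where ab: "e = {a, b}" "a \<noteq> b" by (elim vertex_pairsE)
    have "?S \<subseteq> (\<lambda>k. {a, k}) ` {1..n} \<union> (\<lambda>k. {b, k}) ` {1..n}"
    proof
      fix f assume f: "f \<in> ?S"
      then have "f \<in> ?V" by auto
      then obtain c d where "f = {c, d}" "c \<in> {1..n}" "d \<in> {1..n}" by (elim vertex_pairsE)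
      then show "f \<in> (\<lambda>k. {a, k}) ` {1..n} \<union> (\<lambda>k. {b, k}) ` {1..n}"
        using f ab by auto
    qed
    then have "card ?S \<le> card ((\<lambda>k. {a, k}) ` {1..n} \<union> (\<lambda>k. {b, k}) ` {1..n})"
      by (intro card_mono) auto
    also have "\<dots> \<le> card ((\<lambda>k. {a, k}) ` {1..n}) + card ((\<lambda>k. {b, k}) ` {1..n})" by (rule card_Un_le)
    also have "\<dots> \<le> card {1..n} + card {1..n}" by (intro add_mono card_image_le) auto
    finally have cS: "real (card ?S) \<le> 2 * real n" by simp
    have "card ?R \<le> card ?V" by (intro card_mono) auto
    then have cR: "real (card ?R) \<le> N" using cN by simp
    have "(\<Sum>f\<in>?V - {e}. T e f) = (\<Sum>f\<in>?S \<union> ?R. T e f)" by (intro sum.cong) auto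
    also have "\<dots> = (\<Sum>f\<in>?S. T e f) + (\<Sum>f\<in>?R. T e f)" by (intro sum.union_disjoint) auto
    also have "\<dots> \<le> real (card ?S) * ((1 / N)\<^sup>2 * A) + real (card ?R) * ((1 / N)\<^sup>2 * B)"
      using e by (intro add_mono sum_bounded_above adj dis) auto
    also have "\<dots> \<le> 2 * real n * ((1 / N)\<^sup>2 * A) + N * ((1 / N)\<^sup>2 * B)"
      using cS cR AB by (intro add_mono mult_right_mono) auto
    finally show ?thesis by (simp add: algebra_simps)
  qed
  have "(\<Sum>e\<in>?V. \<Sum>f\<in>?V - {e}. T e f) \<le> real (card ?V) * ((1 / N)\<^sup>2 * (2 * real n * A + N * B))"
    by (intro sum_bounded_above row)
  also have "\<dots> = (1 / N) * (2 * real n * A + N * B)"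
    unfolding cN using N by (simp add: power2_eq_square)
  finally show ?thesis unfolding T_def A_def B_def .
qed

text \<open>The squared normalisation times (p (1 - p))^2 is at most 2 n x with x = n p. Against it,
  adjacent pairs contribute of order 1 / (n x^2) and disjoint pairs of order p / x^4.\<close>

lemma avg_jaccard_linear_approximation:
  assumes n: "6 \<le> n" and p: "0 < p" "p < 1" and x: "1 \<le> real n * p"
  defines "d \<equiv> 4 * (1 - (1 - p) ^ (2 * (n - 2))) / (real n * (real n - 1) * (2 - p)\<^sup>2)"
    and "\<alpha> \<equiv> real n * (2 - p)\<^sup>2 / sqrt (8 * p * (1 - p))"
  shows "subset_exp p (vertex_pairs n)
      (\<lambda>X. (\<alpha> * (avg_jaccard n p X - p / (2 - p)) - \<alpha> * d * centred_sum p (vertex_pairs n) X)\<^sup>2)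
    \<le> 50000000 / (real n * p)"
proof -
  let ?V = "vertex_pairs n"
  let ?E = "subset_exp p ?V"
  define N where "N = real n * (real n - 1) / 2"
  define x where "x = real n * p"
  have x1: "1 \<le> x" using x by (simp add: x_def)
  have N: "0 < N" "real n ^ 2 / 4 \<le> N" using n by (auto simp: N_def power2_eq_square field_simps)
  define S where "S = (1 / N) * (2 * real n * (2580640 / x\<^sup>2) + N * (258048 * p / x ^ 4))"
  have "?E (\<lambda>X. (avg_jaccard n p X - ?E (avg_jaccard n p) - d * centred_sum p ?V X)\<^sup>2)
    \<le> (p * (1 - p))\<^sup>2 * (\<Sum>e\<in>?V. \<Sum>f\<in>?V - {e}. ?E (\<lambda>X. (flip_diff f (flip_diff e (avg_jaccard n p)) X)\<^sup>2))"
    using n p unfolding d_def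
    by (intro subset_exp_second_order_poincare subset_exp_flip_diff_avg_jaccard) auto
  also have "\<dots> \<le> (p * (1 - p))\<^sup>2 * S"
    unfolding S_def x_def N_def using n p x by (intro mult_left_mono sum_flip_diff2_avg_jaccard_le) auto
  also have "?E (avg_jaccard n p) = p / (2 - p)" using n p by (intro subset_exp_avg_jaccard) auto
  finally have main: "?E (\<lambda>X. (avg_jaccard n p X - p / (2 - p) - d * centred_sum p ?V X)\<^sup>2) \<le> (p * (1 - p))\<^sup>2 * S" .
  have \<alpha>2: "\<alpha>\<^sup>2 * (p * (1 - p))\<^sup>2 \<le> 2 * real n * x"
  proof -
    have "\<alpha>\<^sup>2 = (real n)\<^sup>2 * (2 - p) ^ 4 / (8 * p * (1 - p))"
      using p by (simp add: \<alpha>_def power_divide power_mult_distrib flip: power_mult)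
    moreover have "y * z / (8 * p * w) * (p * w)\<^sup>2 = y * p / 8 * (z * w)" if "w \<noteq> 0" for y z w :: real
      using p that by (simp add: power2_eq_square)
    ultimately have "\<alpha>\<^sup>2 * (p * (1 - p))\<^sup>2 = (real n)\<^sup>2 * p / 8 * ((2 - p) ^ 4 * (1 - p))"
      using p by simp
    also have "\<dots> \<le> (real n)\<^sup>2 * p / 8 * (2 ^ 4 * 1)"
      using p by (intro mult_left_mono mult_mono power_mono) auto
    finally show ?thesis by (simp add: x_def power2_eq_square mult_ac)
  qed
  have S: "S \<le> 20645120 / (real n * x\<^sup>2) + 258048 * p / x ^ 4"
  proof -
    have "real n / N \<le> 4 / real n" using n N by (simp add: field_simps power2_eq_square)
    then have "5161280 / x\<^sup>2 * (real n / N) \<le> 5161280 / x\<^sup>2 * (4 / real n)" by (intro mult_left_mono) auto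
    moreover have "S = 5161280 / x\<^sup>2 * (real n / N) + 258048 * p / x ^ 4"
      using N by (simp add: S_def distrib_left)
    ultimately show ?thesis by (simp add: mult.commute)
  qed
  have S0: "0 \<le> S" using N p unfolding S_def by simp
  have "?E (\<lambda>X. (\<alpha> * (avg_jaccard n p X - p / (2 - p)) - \<alpha> * d * centred_sum p ?V X)\<^sup>2) =
     ?E (\<lambda>X. \<alpha>\<^sup>2 * (avg_jaccard n p X - p / (2 - p) - d * centred_sum p ?V X)\<^sup>2)"
    by (simp add: right_diff_distrib mult.assoc flip: power_mult_distrib)
  also have "\<dots> = \<alpha>\<^sup>2 * ?E (\<lambda>X. (avg_jaccard n p X - p / (2 - p) - d * centred_sum p ?V X)\<^sup>2)"
    by (rule subset_exp_cmult)
  also have "\<dots> \<le> \<alpha>\<^sup>2 * ((p * (1 - p))\<^sup>2 * S)" by (intro mult_left_mono main) auto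
  also have "\<dots> \<le> (2 * real n * x) * S"
    unfolding mult.assoc[symmetric] by (intro mult_right_mono \<alpha>2[unfolded mult.assoc[symmetric]] S0)
  also have "\<dots> \<le> (2 * real n * x) * (20645120 / (real n * x\<^sup>2) + 258048 * p / x ^ 4)"
    using x1 by (intro mult_left_mono S) auto
  \<comment> \<open>In the second summand the factor p combines with n to x, so no power of n is
    left.\<close>
  also have "\<dots> = 41290240 / x + 516096 / x\<^sup>2"
  proof -
    have "2 * real n * x * (20645120 / (real n * x\<^sup>2)) = 41290240 / x"
      using n x1 by (simp add: power2_eq_square)
    moreover have "2 * real n * x * (258048 * p / x ^ 4) = 516096 * (real n * p) * x / x ^ 4" by simp
    moreover have "516096 * (real n * p) * x / x ^ 4 = 516096 / x\<^sup>2"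
      unfolding x_def[symmetric] using x1 by (simp add: divide_simps eval_nat_numeral)
    ultimately show ?thesis by (simp only: distrib_left)
  qed
  also have "\<dots> \<le> 41290240 / x + 516096 / x"
    using x1 by (intro add_mono divide_left_mono) (auto simp: power2_eq_square)
  also have "\<dots> \<le> 50000000 / x" using x1 by (simp add: divide_right_mono flip: add_divide_distrib)
  finally show ?thesis by (simp add: x_def)
qed

subsection \<open>Characteristic functions\<close>

text \<open>The sampled function is almost surely False outside \<open>A\<close>, so a subset of
  \<open>A\<close> determines it, and its probability is a product over \<open>A\<close>.\<close>

lemma integral_random_subset:
  fixes F :: "'a set \<Rightarrow> 'b::{banach, second_countable_topology}"
  assumes "finite A" "0 \<le> p" "p \<le> 1"
  shows "integral\<^sup>L (measure_pmf (map_pmf (\<lambda>f. {e \<in> A. f e}) (Pi_pmf A False (\<lambda>_. bernoulli_pmf p)))) F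
    = subset_exp p A F"
proof -
  let ?P = "Pi_pmf A False (\<lambda>_. bernoulli_pmf p)"
  let ?M = "map_pmf (\<lambda>f. {e \<in> A. f e}) ?P"
  have pmf: "pmf ?M X = p ^ card X * (1 - p) ^ card (A - X)" if X: "X \<subseteq> A" for X
  proof -
    have "pmf ?M X = measure_pmf.prob ?P ((\<lambda>f. {e \<in> A. f e}) -` {X})"
      by (simp add: pmf_map)
    also have "\<dots> = measure_pmf.prob ?P {\<lambda>e. e \<in> X}"
    proof (intro measure_pmf.finite_measure_eq_AE AE_pmfI)
      fix f assume "f \<in> set_pmf ?P"
      then have "f e = False" if "e \<notin> A" for e
        using that set_Pi_pmf_subset[OF assms(1), of False "\<lambda>_. bernoulli_pmf p"] by auto
      then show "(f \<in> (\<lambda>f. {e \<in> A. f e}) -` {X}) = (f \<in> {\<lambda>e. e \<in> X})"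
        using X by (auto simp: fun_eq_iff)
    qed auto
    also have "\<dots> = pmf ?P (\<lambda>e. e \<in> X)" by (simp add: measure_pmf_single)
    also have "\<dots> = (\<Prod>e\<in>A. if e \<in> X then p else 1 - p)"
      using X assms by (subst pmf_Pi') (auto intro!: prod.cong)
    also have "\<dots> = (\<Prod>e\<in>X. p) * (\<Prod>e\<in>A - X. 1 - p)"
      using X assms(1) by (subst prod.If_cases) (auto simp: Int_absorb1 Diff_eq)
    finally show ?thesis by simp
  qed
  have "integral\<^sup>L (measure_pmf ?M) F = (\<Sum>X\<in>Pow A. pmf ?M X *\<^sub>R F X)"
    using assms(1) by (intro integral_measure_pmf) auto
  also have "\<dots> = subset_exp p A F" unfolding subset_exp_def by (intro sum.cong) (auto simp: pmf)
  finally show ?thesis .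
qed

lemma char_erdos_renyi:
  assumes "0 \<le> p" "p \<le> 1"
  shows "char (distr (erdos_renyi n p) borel Z) t = subset_exp p (vertex_pairs n) (\<lambda>X. iexp (t * Z X))"
proof -
  have "char (distr (erdos_renyi n p) borel Z) t = integral\<^sup>L (measure_pmf (erdos_renyi n p)) (\<lambda>X. iexp (t * Z X))"
    by (simp add: char_def integral_distr)
  also have "\<dots> = subset_exp p (vertex_pairs n) (\<lambda>X. iexp (t * Z X))"
    unfolding erdos_renyi_def by (rule integral_random_subset[OF finite_vertex_pairs assms])
  finally show ?thesis .
qed

lemma subset_exp_iexp_centred_sum:
  assumes "finite A"
  shows "subset_exp p A (\<lambda>X. iexp (s * centred_sum p A X)) =
    (p *\<^sub>R iexp (s * (1 - p)) + (1 - p) *\<^sub>R iexp (- (s * p))) ^ card A"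
  using assms
proof (induction A rule: finite_induct)
  case empty
  then show ?case by (simp add: centred_sum_def)
next
  case (insert x A)
  define \<phi> where "\<phi> = subset_exp p A (\<lambda>X. iexp (s * centred_sum p A X))"
  have 1: "centred_sum p (insert x A) (insert x X) = (1 - p) + centred_sum p A X" for X
  proof -
    have "(\<Sum>y\<in>A. of_bool (y \<in> insert x X) - p) = (\<Sum>y\<in>A. of_bool (y \<in> X) - p)"
      using insert.hyps by (intro sum.cong) auto
    then show ?thesis using insert.hyps by (simp add: centred_sum_def)
  qed
  have 0: "centred_sum p (insert x A) X = - p + centred_sum p A X" if "X \<subseteq> A" for X
    using that insert.hyps by (auto simp: centred_sum_def)
  have "subset_exp p A (\<lambda>X. iexp (s * centred_sum p (insert x A) (insert x X))) =
      subset_exp p A (\<lambda>X. iexp (s * (1 - p)) * iexp (s * centred_sum p A X))"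
    by (simp add: 1 distrib_left exp_add)
  also have "\<dots> = iexp (s * (1 - p)) * \<phi>" unfolding \<phi>_def by (rule subset_exp_cmult)
  finally have a: "subset_exp p A (\<lambda>X. iexp (s * centred_sum p (insert x A) (insert x X))) = iexp (s * (1 - p)) * \<phi>" .
  have "subset_exp p A (\<lambda>X. iexp (s * centred_sum p (insert x A) X)) =
      subset_exp p A (\<lambda>X. iexp (- (s * p)) * iexp (s * centred_sum p A X))"
  proof (rule subset_exp_cong)
    fix X assume "X \<subseteq> A"
    then have "s * centred_sum p (insert x A) X = - (s * p) + s * centred_sum p A X"
      by (simp add: 0 distrib_left right_diff_distrib)
    then show "iexp (s * centred_sum p (insert x A) X) = iexp (- (s * p)) * iexp (s * centred_sum p A X)"
      by (simp only: of_real_add distrib_left exp_add)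
  qed
  also have "\<dots> = iexp (- (s * p)) * \<phi>" unfolding \<phi>_def by (rule subset_exp_cmult)
  finally have b: "subset_exp p A (\<lambda>X. iexp (s * centred_sum p (insert x A) X)) = iexp (- (s * p)) * \<phi>" .
  have "subset_exp p (insert x A) (\<lambda>X. iexp (s * centred_sum p (insert x A) X)) =
      (p *\<^sub>R iexp (s * (1 - p)) + (1 - p) *\<^sub>R iexp (- (s * p))) * \<phi>"
    unfolding subset_exp_insert[OF insert.hyps] a b by (simp only: distrib_right mult_scaleR_left)
  then show ?case using insert by (simp add: \<phi>_def)
qed

text \<open>Taylor expansion to second order under the expectation: the mean is 0, the variance p (1
  - p), and the third absolute moment p (1 - p) ((1 - p)^2 + p^2) is at most p (1 - p).\<close>

lemma centred_bernoulli_char_approx: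
  assumes p: "0 \<le> p" "p \<le> 1"
  shows "cmod ((p *\<^sub>R iexp (s * (1 - p)) + (1 - p) *\<^sub>R iexp (- (s * p))) - of_real (1 - s\<^sup>2 * (p * (1 - p)) / 2))
    \<le> \<bar>s\<bar> ^ 3 * (p * (1 - p)) / 6"
proof -
  define R where "R x = iexp x - (1 + \<i> * of_real x - of_real (x\<^sup>2 / 2))" for x :: real
  have R: "cmod (R x) \<le> \<bar>x\<bar> ^ 3 / 6" for x
    using iexp_approx1[of x 2]
    by (simp add: R_def eval_nat_numeral fact_numeral power2_eq_square algebra_simps)
  have "(p *\<^sub>R iexp (s * (1 - p)) + (1 - p) *\<^sub>R iexp (- (s * p))) - of_real (1 - s\<^sup>2 * (p * (1 - p)) / 2)
    = p *\<^sub>R R (s * (1 - p)) + (1 - p) *\<^sub>R R (- (s * p))"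
  proof -
    have "(of_real p * (1 + \<i> * of_real (s * (1 - p)) - of_real ((s * (1 - p))\<^sup>2 / 2))
        + of_real (1 - p) * (1 + \<i> * of_real (- (s * p)) - of_real ((- (s * p))\<^sup>2 / 2)) :: complex)
        = of_real (1 - s\<^sup>2 * (p * (1 - p)) / 2)"
      by (simp add: complex_eq_iff power2_eq_square field_simps)
    then show ?thesis unfolding R_def scaleR_conv_of_real by (simp only: right_diff_distrib) (simp add: algebra_simps)
  qed
  also have "cmod \<dots> \<le> p * cmod (R (s * (1 - p))) + (1 - p) * cmod (R (- (s * p)))"
    using p by (intro order_trans[OF norm_triangle_ineq]) simp
  also have "\<dots> \<le> p * (\<bar>s * (1 - p)\<bar> ^ 3 / 6) + (1 - p) * (\<bar>- (s * p)\<bar> ^ 3 / 6)"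
    using p by (intro add_mono mult_left_mono R) auto
  also have "\<dots> = \<bar>s\<bar> ^ 3 * (p * (1 - p)) / 6 * ((1 - p)\<^sup>2 + p\<^sup>2)"
    using p by (simp add: abs_mult power_mult_distrib) (simp add: eval_nat_numeral algebra_simps)
  also have "\<dots> \<le> \<bar>s\<bar> ^ 3 * (p * (1 - p)) / 6 * 1"
  proof (intro mult_left_mono)
    have "(1 - p)\<^sup>2 + p\<^sup>2 = 1 - 2 * (p * (1 - p))" by (simp add: power2_eq_square algebra_simps)
    then show "(1 - p)\<^sup>2 + p\<^sup>2 \<le> 1" using p by simp
  qed (use p in auto)
  finally show ?thesis by simp
qed

lemma iexp_diff_le: "cmod (iexp u - iexp v) \<le> \<bar>u - v\<bar>"
proof -
  have "iexp u - iexp v = iexp v * (iexp (u - v) - 1)"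
    by (simp add: right_diff_distrib exp_diff)
  then have "cmod (iexp u - iexp v) = cmod (iexp (u - v) - 1)" by (simp add: norm_mult)
  also have "\<dots> \<le> \<bar>u - v\<bar>" using iexp_approx1[of "u - v" 0] by simp
  finally show ?thesis .
qed

text \<open>Combines the Lipschitz bound for \<open>iexp\<close> with Jensen, so closeness in mean
  square passes to characteristic functions.\<close>

lemma subset_exp_iexp_diff_le:
  assumes "0 \<le> p" "p \<le> 1" "finite A"
  shows "cmod (subset_exp p A (\<lambda>X. iexp (t * Z X)) - subset_exp p A (\<lambda>X. iexp (t * Y X)))
    \<le> \<bar>t\<bar> * sqrt (subset_exp p A (\<lambda>X. (Z X - Y X)\<^sup>2))"
proof -
  have "cmod (subset_exp p A (\<lambda>X. iexp (t * Z X)) - subset_exp p A (\<lambda>X. iexp (t * Y X)))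
     \<le> subset_exp p A (\<lambda>X. cmod (iexp (t * Z X) - iexp (t * Y X)))"
    unfolding subset_exp_diff[symmetric] using assms by (intro norm_subset_exp_le)
  also have "\<dots> \<le> subset_exp p A (\<lambda>X. \<bar>t\<bar> * \<bar>Z X - Y X\<bar>)"
    using assms by (intro subset_exp_mono order_trans[OF iexp_diff_le]) (auto simp: right_diff_distrib simp flip: abs_mult)
  also have "\<dots> = \<bar>t\<bar> * subset_exp p A (\<lambda>X. \<bar>Z X - Y X\<bar>)" by (rule subset_exp_cmult)
  also have "subset_exp p A (\<lambda>X. \<bar>Z X - Y X\<bar>) \<le> sqrt (subset_exp p A (\<lambda>X. (Z X - Y X)\<^sup>2))"
    using subset_exp_square[OF assms, of "\<lambda>X. \<bar>Z X - Y X\<bar>"] by (intro real_le_rsqrt) simp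
  finally show ?thesis by (simp add: mult_left_mono)
qed

text \<open>The success probability varies with n, so this is a triangular array. The N third-order
  errors add up to |t|^3 / (6 sqrt v), where v is the variance, and vanish as v grows.\<close>

lemma binomial_char_tendsto:
  fixes p :: "nat \<Rightarrow> real" and N :: "nat \<Rightarrow> nat" and t :: real
  assumes p: "\<forall>\<^sub>F n in sequentially. 0 < p n \<and> p n < 1"
    and N: "filterlim N at_top sequentially"
    and var: "filterlim (\<lambda>n. real (N n) * p n * (1 - p n)) at_top sequentially"
  defines "s \<equiv> \<lambda>n. t / sqrt (real (N n) * p n * (1 - p n))"
  shows "(\<lambda>n. (p n *\<^sub>R iexp (s n * (1 - p n)) + (1 - p n) *\<^sub>R iexp (- (s n * p n))) ^ N n)
    \<longlonglongrightarrow> of_real (exp (- t\<^sup>2 / 2))"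
proof -
  let ?\<psi> = "\<lambda>n. p n *\<^sub>R iexp (s n * (1 - p n)) + (1 - p n) *\<^sub>R iexp (- (s n * p n))"
  let ?v = "\<lambda>n. real (N n) * p n * (1 - p n)"
  have ev: "\<forall>\<^sub>F n in sequentially. cmod (?\<psi> n ^ N n - of_real ((1 + (- t\<^sup>2 / 2) / real (N n)) ^ N n)) \<le> \<bar>t\<bar> ^ 3 / 6 * (1 / sqrt (?v n))"
    \<comment> \<open>The threshold makes N at least t^2, so 1 - t^2 / (2 N) lies between 1/2 and 1;
      the comparison of N-th powers needs both bases in the unit disc.\<close>
    using p filterlim_at_top[THEN iffD1, OF N, rule_format, of "Suc (nat \<lceil>t\<^sup>2\<rceil>)"]
  proof eventually_elim
    case (elim n)
    then have pn: "0 < p n" "p n < 1" and Nn: "t\<^sup>2 \<le> real (N n)" "0 < N n" by linarith+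
    have v: "0 < ?v n" using pn Nn by simp
    have s2: "(s n)\<^sup>2 * (p n * (1 - p n)) = t\<^sup>2 / real (N n)"
      unfolding s_def power_divide using v pn Nn by (simp add: less_imp_le)
    define b where "b = 1 + (- t\<^sup>2 / 2) / real (N n)"
    have b: "1 - (s n)\<^sup>2 * (p n * (1 - p n)) / 2 = b"
      unfolding s2 b_def by simp
    have close: "cmod (?\<psi> n - of_real b) \<le> \<bar>s n\<bar> ^ 3 * (p n * (1 - p n)) / 6"
      unfolding b[symmetric] using pn by (intro centred_bernoulli_char_approx) auto
    have err: "real (N n) * (\<bar>s n\<bar> ^ 3 * (p n * (1 - p n)) / 6) = \<bar>t\<bar> ^ 3 / 6 * (1 / sqrt (?v n))"
    proof -
      have "\<bar>s n\<bar> ^ 3 = \<bar>s n\<bar> * (s n)\<^sup>2" by (simp add: eval_nat_numeral)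
      then have "real (N n) * (\<bar>s n\<bar> ^ 3 * (p n * (1 - p n)) / 6) = real (N n) * \<bar>s n\<bar> * ((s n)\<^sup>2 * (p n * (1 - p n))) / 6"
        by simp
      also have "\<dots> = \<bar>s n\<bar> * t\<^sup>2 / 6" unfolding s2 using Nn by simp
      also have "\<dots> = \<bar>t\<bar> ^ 3 / 6 * (1 / sqrt (?v n))"
      proof -
        have "\<bar>s n\<bar> = \<bar>t\<bar> / sqrt (?v n)" using v by (simp add: s_def)
        then show ?thesis by (simp add: eval_nat_numeral)
      qed
      finally show ?thesis .
    qed
    have \<psi>1: "cmod (?\<psi> n) \<le> 1"
      using pn by (intro order_trans[OF norm_triangle_ineq]) simp
    have b1: "cmod (of_real b) \<le> 1"
    proof -
      have "t\<^sup>2 / real (N n) \<le> 1" "0 \<le> t\<^sup>2 / real (N n)" using Nn by auto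
      then show ?thesis unfolding norm_of_real b_def by (simp add: abs_le_iff)
    qed
    have "cmod (?\<psi> n ^ N n - of_real (b ^ N n)) \<le> real (N n) * cmod (?\<psi> n - of_real b)"
      unfolding of_real_power by (rule norm_power_diff[OF \<psi>1 b1])
    also have "\<dots> \<le> real (N n) * (\<bar>s n\<bar> ^ 3 * (p n * (1 - p n)) / 6)"
      by (intro mult_left_mono close) simp
    finally show ?case unfolding err b_def .
  qed
  have "(\<lambda>n. \<bar>t\<bar> ^ 3 / 6 * (1 / sqrt (?v n))) \<longlonglongrightarrow> \<bar>t\<bar> ^ 3 / 6 * 0"
    by (intro tendsto_mult tendsto_const tendsto_divide_0[OF tendsto_const] filterlim_at_top_imp_at_infinity
        filterlim_compose[OF sqrt_at_top var])
  then have "(\<lambda>n. \<bar>t\<bar> ^ 3 / 6 * (1 / sqrt (?v n))) \<longlonglongrightarrow> 0" by simp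
  then have "(\<lambda>n. ?\<psi> n ^ N n - of_real ((1 + (- t\<^sup>2 / 2) / real (N n)) ^ N n)) \<longlonglongrightarrow> 0"
    by (rule Lim_null_comparison[OF ev])
  moreover have "(\<lambda>n. of_real ((1 + (- t\<^sup>2 / 2) / real (N n)) ^ N n) :: complex) \<longlonglongrightarrow> of_real (exp (- t\<^sup>2 / 2))"
    by (intro tendsto_of_real filterlim_compose[OF tendsto_exp_limit_sequentially N])
  ultimately show ?thesis by (rule Lim_transform[rotated])
qed

text \<open>The product simplifies to (1 - (1 - p)^(2 (n - 2))) sqrt (n / (n - 1)). The power is the
  probability of the degenerate case T = 0, and it is at most exp (- n p) once n >= 4.\<close>

lemma linear_coefficient_tendsto:
  fixes p :: "nat \<Rightarrow> real"
  assumes p: "\<forall>\<^sub>F n in sequentially. 0 < p n \<and> p n < 1"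
    and np: "filterlim (\<lambda>n. real n * p n) at_top sequentially"
  shows "(\<lambda>n. real n * (2 - p n)\<^sup>2 / sqrt (8 * p n * (1 - p n))
      * (4 * (1 - (1 - p n) ^ (2 * (n - 2))) / (real n * (real n - 1) * (2 - p n)\<^sup>2))
      * sqrt (real n * (real n - 1) / 2 * p n * (1 - p n))) \<longlonglongrightarrow> 1"
proof -
  have A: "(\<lambda>n. (1 - p n) ^ (2 * (n - 2))) \<longlonglongrightarrow> 0"
  proof (rule Lim_null_comparison)
    show "\<forall>\<^sub>F n in sequentially. norm ((1 - p n) ^ (2 * (n - 2))) \<le> exp (- (real n * p n))"
      using p eventually_ge_at_top[of 4]
    proof eventually_elim
      case (elim n)
      have "(1 - p n) ^ (2 * (n - 2)) \<le> exp (- p n) ^ (2 * (n - 2))"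
        using elim exp_ge_add_one_self[of "- p n"] by (intro power_mono) auto
      also have "\<dots> = exp (- (real (2 * (n - 2)) * p n))" by (simp flip: exp_of_nat_mult)
      also have "\<dots> \<le> exp (- (real n * p n))"
        using elim by (simp add: of_nat_diff mult_right_mono)
      finally show ?case using elim by simp
    qed
    show "(\<lambda>n. exp (- (real n * p n))) \<longlonglongrightarrow> 0"
      by (intro filterlim_compose[OF exp_at_bot] filterlim_compose[OF filterlim_uminus_at_bot_at_top np])
  qed
  have "filterlim (\<lambda>n. - 1 + real n) at_top sequentially"
    by (intro filterlim_tendsto_add_at_top[OF tendsto_const filterlim_real_sequentially])
  then have "(\<lambda>n. 1 / (- 1 + real n)) \<longlonglongrightarrow> 0"
    by (intro tendsto_divide_0[OF tendsto_const] filterlim_at_top_imp_at_infinity)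
  then have "(\<lambda>n. (1 - (1 - p n) ^ (2 * (n - 2))) * sqrt (1 + 1 / (- 1 + real n))) \<longlonglongrightarrow> (1 - 0) * sqrt (1 + 0)"
    by (intro tendsto_intros A)
  then have lim: "(\<lambda>n. (1 - (1 - p n) ^ (2 * (n - 2))) * sqrt (1 + 1 / (- 1 + real n))) \<longlonglongrightarrow> 1"
    by simp
  show ?thesis
  proof (rule Lim_transform_eventually[OF lim])
    show "\<forall>\<^sub>F n in sequentially. (1 - (1 - p n) ^ (2 * (n - 2))) * sqrt (1 + 1 / (- 1 + real n)) =
      real n * (2 - p n)\<^sup>2 / sqrt (8 * p n * (1 - p n))
      * (4 * (1 - (1 - p n) ^ (2 * (n - 2))) / (real n * (real n - 1) * (2 - p n)\<^sup>2))
      * sqrt (real n * (real n - 1) / 2 * p n * (1 - p n))"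
      using p eventually_ge_at_top[of 2]
    proof eventually_elim
      case (elim n)
      define u where "u = 1 - (1 - p n) ^ (2 * (n - 2))"
      define m where "m = real n"
      have m: "2 \<le> m" using elim by (simp add: m_def)
      define w where "w = sqrt (8 * p n * (1 - p n))"
      have w: "0 < w" using elim by (simp add: w_def)
      define c where "c = 8 * p n * (1 - p n)"
      \<comment> \<open>The factor 8 p (1 - p) is split off to cancel the root in the normalisation;
        1 + 1 / (m - 1) = m / (m - 1).\<close>
      have "m * (m - 1) / 2 * p n * (1 - p n) = (1 + 1 / (- 1 + m)) * ((m - 1) / 4)\<^sup>2 * c"
        using m by (simp add: c_def divide_simps power2_eq_square)
      then have "sqrt (m * (m - 1) / 2 * p n * (1 - p n)) = sqrt (1 + 1 / (- 1 + m)) * \<bar>(m - 1) / 4\<bar> * sqrt c"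
        by (simp only: real_sqrt_mult[of "_ * _" c] real_sqrt_mult[of _ "_\<^sup>2"] real_sqrt_abs)
      moreover have "\<bar>(m - 1) / 4\<bar> = (m - 1) / 4" using m by simp
      ultimately have "sqrt (m * (m - 1) / 2 * p n * (1 - p n)) = sqrt (1 + 1 / (- 1 + m)) * ((m - 1) / 4) * w"
        unfolding w_def c_def by (simp only:)
      moreover have "m * (2 - p n)\<^sup>2 / w * (4 * u / (m * (m - 1) * (2 - p n)\<^sup>2)) * (z * ((m - 1) / 4) * w) = u * z" for z
      proof -
        have "(2 - p n)\<^sup>2 \<noteq> 0" "m \<noteq> 0" "m - 1 \<noteq> 0" "w \<noteq> 0" using elim m w by auto
        then show ?thesis by (simp add: field_simps)
      qed
      ultimately show ?case unfolding u_def[symmetric] m_def[symmetric] w_def[symmetric] by (simp only:)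
    qed
  qed
qed

theorem theorem2:
  fixes p :: "nat \<Rightarrow> real"
  assumes "\<And>n. n \<ge> 2 \<Longrightarrow> 0 \<le> p n \<and> p n \<le> 1"
    and "filterlim (\<lambda>n. real n * p n) at_top sequentially"
    and "filterlim (\<lambda>n. (real n)\<^sup>2 * (1 - p n)) at_top sequentially"
  shows "weak_conv_m
    (\<lambda>n. distr (erdos_renyi n (p n)) borel
      (\<lambda>E. real n * (2 - p n)\<^sup>2 / sqrt (8 * p n * (1 - p n))
            * (avg_jaccard n (p n) E - p n / (2 - p n))))
    std_normal_distribution"
proof (rule levy_continuity)
  define Z where "Z n E = real n * (2 - p n)\<^sup>2 / sqrt (8 * p n * (1 - p n))
            * (avg_jaccard n (p n) E - p n / (2 - p n))" for n E
  show "real_distribution (distr (erdos_renyi n (p n)) borel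
      (\<lambda>E. real n * (2 - p n)\<^sup>2 / sqrt (8 * p n * (1 - p n))
            * (avg_jaccard n (p n) E - p n / (2 - p n))))" for n
    by (rule prob_space.real_distribution_distr[OF prob_space_measure_pmf]) simp
  show "real_distribution std_normal_distribution" by (rule real_dist_normal_dist)
  fix t :: real
  define N where "N n = card (vertex_pairs n)" for n
  define v where "v n = real (N n) * p n * (1 - p n)" for n
  define \<alpha> where "\<alpha> n = real n * (2 - p n)\<^sup>2 / sqrt (8 * p n * (1 - p n))" for n
  define d where "d n = 4 * (1 - (1 - p n) ^ (2 * (n - 2))) / (real n * (real n - 1) * (2 - p n)\<^sup>2)" for n
  \<comment> \<open>Coefficient of the standardised edge count \<open>Y n\<close> in the linear
    approximation of \<open>Z n\<close>.\<close>
  define \<kappa> where "\<kappa> n = \<alpha> n * d n * sqrt (v n)" for n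
  define Y where "Y n X = centred_sum (p n) (vertex_pairs n) X / sqrt (v n)" for n X
  have N: "real (N n) = real n * (real n - 1) / 2" for n
    unfolding N_def by (rule card_vertex_pairs)
  have np1: "\<forall>\<^sub>F n in sequentially. 1 \<le> real n * p n"
    using assms(2) by (auto simp: filterlim_at_top)
  have nq1: "\<forall>\<^sub>F n in sequentially. 1 \<le> (real n)\<^sup>2 * (1 - p n)"
    using assms(3) by (auto simp: filterlim_at_top)
  \<comment> \<open>Strictness comes from the growth conditions: n p >= 1 excludes p = 0, and n^2 (1
    - p) >= 1 excludes p = 1.\<close>
  have p: "\<forall>\<^sub>F n in sequentially. 0 < p n \<and> p n < 1"
    using np1 nq1 eventually_ge_at_top[of 2]
  proof eventually_elim
    case (elim n)
    then have "p n \<noteq> 0" "p n \<noteq> 1" by auto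
    then show ?case using assms(1)[OF elim(3)] by linarith
  qed
  have Ninf: "filterlim N at_top sequentially"
  proof (rule filterlim_at_top_mono[OF filterlim_ident])
    show "\<forall>\<^sub>F n in sequentially. n \<le> N n"
      using eventually_ge_at_top[of 3]
    proof eventually_elim
      case (elim n)
      have "2 * real n \<le> real n * (real n - 1)"
        using elim mult_left_mono[of 2 "real n - 1" "real n"] by simp
      then have "real n \<le> real (N n)" by (simp add: N)
      then show ?case by simp
    qed
  qed
  have vinf: "filterlim v at_top sequentially"
    unfolding filterlim_at_top
  proof
    fix B :: real
    have "\<forall>\<^sub>F n in sequentially. 8 * B \<le> real n * p n" "\<forall>\<^sub>F n in sequentially. 8 * B \<le> (real n)\<^sup>2 * (1 - p n)"
      using assms(2,3) by (auto simp: filterlim_at_top)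
    then show "\<forall>\<^sub>F n in sequentially. B \<le> v n"
      using p eventually_ge_at_top[of 2]
    proof eventually_elim
      case (elim n)
      have N4: "(real n)\<^sup>2 / 4 \<le> real (N n)"
        using elim mult_left_mono[of 2 "real n" "real n"] unfolding N by (simp add: power2_eq_square field_simps)
      have "(real n)\<^sup>2 / 4 * (p n * (1 - p n)) \<le> real (N n) * (p n * (1 - p n))"
        using N4 elim by (intro mult_right_mono) auto
      then have v: "(real n)\<^sup>2 / 4 * (p n * (1 - p n)) \<le> v n" by (simp add: v_def mult.assoc)
      \<comment> \<open>The smaller of p and 1 - p is controlled by its own growth condition while
        the other is at least 1/2. The constant 8 is 4, from N >= n^2 / 4, times 2.\<close>
      show ?case
      proof (cases "p n \<le> 1 / 2")
        case True
        have "real n * 1 \<le> (real n)\<^sup>2"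
          unfolding power2_eq_square using elim by (intro mult_left_mono) auto
        then have "real n / 4 * (p n * (1 / 2)) \<le> (real n)\<^sup>2 / 4 * (p n * (1 - p n))"
          using True elim by (intro mult_mono) auto
        moreover have "B \<le> real n / 4 * (p n * (1 / 2))" using elim by simp
        ultimately show ?thesis using v by linarith
      next
        case False
        have "(real n)\<^sup>2 / 4 * (1 / 2 * (1 - p n)) \<le> (real n)\<^sup>2 / 4 * (p n * (1 - p n))"
          using False elim by (intro mult_left_mono mult_right_mono) auto
        moreover have "B \<le> (real n)\<^sup>2 / 4 * (1 / 2 * (1 - p n))" using elim by simp
        ultimately show ?thesis using v by linarith
      qed
    qed
  qed
  have \<kappa>: "\<kappa> \<longlonglongrightarrow> 1"
    using linear_coefficient_tendsto[OF p assms(2)] unfolding \<kappa>_def \<alpha>_def d_def v_def N .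
  have clt: "(\<lambda>n. subset_exp (p n) (vertex_pairs n) (\<lambda>X. iexp (t * Y n X))) \<longlonglongrightarrow> of_real (exp (- t\<^sup>2 / 2))"
  proof -
    have "(\<lambda>n. subset_exp (p n) (vertex_pairs n) (\<lambda>X. iexp (t * Y n X))) =
      (\<lambda>n. (p n *\<^sub>R iexp (t / sqrt (v n) * (1 - p n)) + (1 - p n) *\<^sub>R iexp (- (t / sqrt (v n) * p n))) ^ N n)"
      unfolding N_def by (subst subset_exp_iexp_centred_sum[symmetric]) (simp_all add: Y_def)
    then show ?thesis
      using binomial_char_tendsto[OF p Ninf vinf[unfolded v_def], of t] unfolding v_def by simp
  qed
  have bound: "\<forall>\<^sub>F n in sequentially.
     norm (char (distr (erdos_renyi n (p n)) borel (Z n)) t - subset_exp (p n) (vertex_pairs n) (\<lambda>X. iexp (t * Y n X)))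
     \<le> \<bar>t\<bar> * sqrt (100000000 / (real n * p n) + 2 * (\<kappa> n - 1)\<^sup>2)"
    using p np1 eventually_ge_at_top[of 6]
  proof eventually_elim
    case (elim n)
    let ?E = "subset_exp (p n) (vertex_pairs n)"
    have v: "0 < v n" using elim by (simp add: v_def N)
    have pn: "0 \<le> p n" "p n \<le> 1" using elim by auto
    have 1: "?E (\<lambda>X. (Z n X - \<kappa> n * Y n X)\<^sup>2) \<le> 50000000 / (real n * p n)"
    proof -
      have "\<kappa> n * Y n X = \<alpha> n * d n * centred_sum (p n) (vertex_pairs n) X" for X
        using v by (simp add: \<kappa>_def Y_def)
      then show ?thesis
        using avg_jaccard_linear_approximation[of n "p n"] elim unfolding Z_def \<alpha>_def d_def by simp
    qed
    have 2: "?E (\<lambda>X. (Y n X)\<^sup>2) \<le> 1"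
    proof -
      have "?E (\<lambda>X. (Y n X)\<^sup>2) = ?E (\<lambda>X. 1 / v n * (centred_sum (p n) (vertex_pairs n) X)\<^sup>2)"
        using v by (simp add: Y_def power_divide)
      also have "\<dots> = 1 / v n * ?E (\<lambda>X. (centred_sum (p n) (vertex_pairs n) X)\<^sup>2)" by (rule subset_exp_cmult)
      also have "\<dots> \<le> 1 / v n * v n"
        using subset_exp_centred_sum_square[OF pn finite_vertex_pairs, of n] v
        by (intro mult_left_mono) (auto simp: v_def N_def)
      finally show ?thesis using v by simp
    qed
    \<comment> \<open>Splits Z - Y into (Z - \<kappa> Y) + (\<kappa> - 1) Y: the approximation error
      and the deviation of the coefficient from 1.\<close>
    have "?E (\<lambda>X. (Z n X - Y n X)\<^sup>2) \<le> ?E (\<lambda>X. 2 * (Z n X - \<kappa> n * Y n X)\<^sup>2 + 2 * (\<kappa> n - 1)\<^sup>2 * (Y n X)\<^sup>2)"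
    proof (rule subset_exp_mono[OF pn])
      fix X
      have "(x + y)\<^sup>2 \<le> 2 * x\<^sup>2 + 2 * y\<^sup>2" for x y :: real
        using sum_squares_bound[of x y] by (simp add: power2_eq_square algebra_simps)
      from this[of "Z n X - \<kappa> n * Y n X" "(\<kappa> n - 1) * Y n X"]
      show "(Z n X - Y n X)\<^sup>2 \<le> 2 * (Z n X - \<kappa> n * Y n X)\<^sup>2 + 2 * (\<kappa> n - 1)\<^sup>2 * (Y n X)\<^sup>2"
        unfolding power_mult_distrib by (simp add: left_diff_distrib mult.assoc)
    qed
    also have "\<dots> = 2 * ?E (\<lambda>X. (Z n X - \<kappa> n * Y n X)\<^sup>2) + 2 * (\<kappa> n - 1)\<^sup>2 * ?E (\<lambda>X. (Y n X)\<^sup>2)"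
      by (simp only: subset_exp_add subset_exp_cmult)
    also have "\<dots> \<le> 2 * (50000000 / (real n * p n)) + 2 * (\<kappa> n - 1)\<^sup>2 * 1"
      using 1 2 by (intro add_mono mult_left_mono) auto
    finally have 3: "?E (\<lambda>X. (Z n X - Y n X)\<^sup>2) \<le> 100000000 / (real n * p n) + 2 * (\<kappa> n - 1)\<^sup>2" by simp
    have "norm (char (distr (erdos_renyi n (p n)) borel (Z n)) t - ?E (\<lambda>X. iexp (t * Y n X)))
      \<le> \<bar>t\<bar> * sqrt (?E (\<lambda>X. (Z n X - Y n X)\<^sup>2))"
      unfolding char_erdos_renyi[OF pn] by (intro subset_exp_iexp_diff_le pn) simp
    also have "\<dots> \<le> \<bar>t\<bar> * sqrt (100000000 / (real n * p n) + 2 * (\<kappa> n - 1)\<^sup>2)"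
      using 3 by (intro mult_left_mono real_sqrt_le_mono) auto
    finally show ?case .
  qed
  have "(\<lambda>n. \<bar>t\<bar> * sqrt (100000000 / (real n * p n) + 2 * (\<kappa> n - 1)\<^sup>2)) \<longlonglongrightarrow> \<bar>t\<bar> * sqrt (0 + 2 * (1 - 1)\<^sup>2)"
    by (intro tendsto_intros \<kappa> tendsto_divide_0[OF tendsto_const] filterlim_at_top_imp_at_infinity assms(2))
  then have "(\<lambda>n. \<bar>t\<bar> * sqrt (100000000 / (real n * p n) + 2 * (\<kappa> n - 1)\<^sup>2)) \<longlonglongrightarrow> 0" by simp
  from Lim_null_comparison[OF bound this]
  have "(\<lambda>n. char (distr (erdos_renyi n (p n)) borel (Z n)) t) \<longlonglongrightarrow> of_real (exp (- t\<^sup>2 / 2))"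
    using clt by (rule Lim_transform[rotated])
  then show "(\<lambda>n. char (distr (erdos_renyi n (p n)) borel
      (\<lambda>E. real n * (2 - p n)\<^sup>2 / sqrt (8 * p n * (1 - p n))
            * (avg_jaccard n (p n) E - p n / (2 - p n)))) t) \<longlonglongrightarrow> char std_normal_distribution t"
    unfolding Z_def char_std_normal_distribution .
qed

end
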